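(* A flat totally geodesic almost complex surface $M$ of the nearly Kähler manifold $(SL(2,\mathbb{R})\times SL(2,\mathbb{R}),g,J)$ with negative definite induced metric is isometric (i.e. congruent by an isometry of the ambient space) to the immersion $(s,t)\mapsto (A(s,t),B(s,t))$, where $$A(s,t)=\begin{pmatrix}\cos\left(\frac{1}{\sqrt2}(\sqrt3 s-t)\right)&\sin\left(\frac{1}{\sqrt2}(\sqrt3 s-t)\right)\\-\sin\left(\frac{1}{\sqrt2}(\sqrt3 s-t)\right)&\cos\left(\frac{1}{\sqrt2}(\sqrt3 s-t)\right)\end{pmatrix}$$ and $$B(s,t)=\begin{pmatrix}\cos\left(\frac{1}{\sqrt2}(\sqrt3 s+t)\right)&\sin\left(\frac{1}{\sqrt2}(\sqrt3 s+t)\right)\\-\sin\left(\frac{1}{\sqrt2}(\sqrt3 s+t)\right)&\cos\left(\frac{1}{\sqrt2}(\sqrt3 s+t)\right)\end{pmatrix},\qquad (s,t)\in\mathbb{R}^2.$$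
   Context: For trace-zero real $2\times2$ matrices put $\langle\alpha,\beta\rangle=\tfrac12\operatorname{Trace}(\alpha\beta)$. One has $T_ASL(2,\mathbb{R})=\{A\alpha:\operatorname{Trace}\alpha=0\}$, so tangent vectors of $SL(2,\mathbb{R})\times SL(2,\mathbb{R})$ at $(A,B)$ are the pairs $(A\alpha,B\beta)$ with $\alpha,\beta$ real $2\times 2$ matrices of trace $0$. The pseudo-Riemannian metric $g$ and the almost complex structure $J$ are $$g((A\alpha,B\beta),(A\gamma,B\delta))=\tfrac23\big(\langle\alpha,\gamma\rangle+\langle\beta,\delta\rangle\big)-\tfrac13\big(\langle\beta,\gamma\rangle+\langle\alpha,\delta\rangle\big),$$ $$J(A\alpha,B\beta)=\tfrac{1}{\sqrt3}\big(A(\alpha-2\beta),B(2\alpha-\beta)\big).$$ With these, $(SL(2,\mathbb{R})\times SL(2,\mathbb{R}),g,J)$ is a nearly Kähler manifold. An almost complex surface is an immersed 2-dimensional connected submanifold $M$ (with immersion $F$) whose tangent spaces are $J$-invariant. The second fundamental form $h$ and the Gaussian curvature (of the induced metric) are taken with respect to $g$. Totally geodesic means $h=0$; flat means Gaussian curvature $0$. $M$ is congruent to a surface with image $\Sigma\subset SL(2,\mathbb{R})\times SL(2,\mathbb{R})$ if there is an isometry $\Phi$ of $(SL(2,\mathbb{R})\times SL(2,\mathbb{R}),g)$ such that $\Phi(F(M))$ is an open part of $\Sigma$. *)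

theory Defs
  imports "HOL-Analysis.Analysis"
begin

section \<open>Smooth maps\<close>

abbreviation dderiv ::
  "('a::real_normed_vector \<Rightarrow> 'b::real_normed_vector) \<Rightarrow> 'a set \<Rightarrow> 'a \<Rightarrow> 'a \<Rightarrow> 'b" where
  "dderiv f S p v \<equiv> frechet_derivative f (at p within S) v"

text \<open>\<open>Ck k W f\<close> is meant for open \<open>W\<close>.\<close>

primrec Ck :: "nat \<Rightarrow> 'a::euclidean_space set \<Rightarrow> ('a \<Rightarrow> 'b::real_normed_vector) \<Rightarrow> bool" where
  "Ck 0 W f \<longleftrightarrow> continuous_on W f"
| "Ck (Suc k) W f \<longleftrightarrow>
     (\<forall>p\<in>W. f differentiable (at p)) \<and> (\<forall>v. Ck k W (\<lambda>p. frechet_derivative f (at p) v))"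

text \<open>A map on an arbitrary subset of a Euclidean space is smooth if it extends locally to
  \<open>C\<^sup>\<infinity>\<close> maps on open sets. If \<open>S\<close> is an embedded submanifold and \<open>v\<close> is tangent to \<open>S\<close> at
  \<open>p\<close>, then \<open>dderiv f S p v\<close> is the differential of the smooth map \<open>f\<close> applied to \<open>v\<close>: all
  derivatives of \<open>f\<close> at \<open>p\<close> within \<open>S\<close> agree on tangent vectors.\<close>

definition smooth_on :: "'a::euclidean_space set \<Rightarrow> ('a \<Rightarrow> 'b::real_normed_vector) \<Rightarrow> bool" where
  "smooth_on S f \<longleftrightarrow>
     (\<forall>p\<in>S. \<exists>W h. open W \<and> p \<in> W \<and> (\<forall>k. Ck k W h) \<and> (\<forall>x\<in>W \<inter> S. h x = f x))"

section \<open>Pseudo-Riemannian geometry of embedded submanifolds\<close>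

text \<open>Throughout, \<open>S\<close> is an embedded submanifold of a Euclidean space (possibly an open subset),
  \<open>T p\<close> is its tangent space at \<open>p\<close>, and \<open>g p\<close> is a metric on \<open>T p\<close>, not in general the one
  induced from the ambient inner product.\<close>

definition vector_field ::
  "'a::euclidean_space set \<Rightarrow> ('a \<Rightarrow> 'a set) \<Rightarrow> ('a \<Rightarrow> 'a) \<Rightarrow> bool" where
  "vector_field S T X \<longleftrightarrow> smooth_on S X \<and> (\<forall>p\<in>S. X p \<in> T p)"

definition lie_bracket ::
  "'a::euclidean_space set \<Rightarrow> ('a \<Rightarrow> 'a) \<Rightarrow> ('a \<Rightarrow> 'a) \<Rightarrow> 'a \<Rightarrow> 'a" where
  "lie_bracket S X Y p = dderiv Y S p (X p) - dderiv X S p (Y p)"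

text \<open>The difference of an affine connection on \<open>S\<close> and the directional derivative of the ambient
  vector space is tensorial, so affine connections on \<open>S\<close> are the operators \<open>nabla S C\<close> with
  \<open>C p\<close> bilinear on \<open>T p\<close> that map pairs of tangent fields to tangent fields.\<close>

definition nabla ::
  "'a::euclidean_space set \<Rightarrow> ('a \<Rightarrow> 'a \<Rightarrow> 'a \<Rightarrow> 'a) \<Rightarrow> ('a \<Rightarrow> 'a) \<Rightarrow> ('a \<Rightarrow> 'a) \<Rightarrow> 'a \<Rightarrow> 'a" where
  "nabla S C X Y p = dderiv Y S p (X p) + C p (X p) (Y p)"

text \<open>The last two conditions are vanishing torsion and compatibility with \<open>g\<close>. Smoothness of
  \<open>nabla S C X Y\<close> is not required because it follows: by the Koszul formula, \<open>C p\<close> is uniquely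
  determined on \<open>T p\<close>.\<close>

definition is_levi_civita ::
  "'a::euclidean_space set \<Rightarrow> ('a \<Rightarrow> 'a set) \<Rightarrow> ('a \<Rightarrow> 'a \<Rightarrow> 'a \<Rightarrow> real) \<Rightarrow>
     ('a \<Rightarrow> 'a \<Rightarrow> 'a \<Rightarrow> 'a) \<Rightarrow> bool" where
  "is_levi_civita S T g C \<longleftrightarrow>
     (\<forall>p\<in>S. \<forall>u\<in>T p. \<forall>v\<in>T p. \<forall>w\<in>T p. \<forall>a b.
        C p (a *\<^sub>R u + b *\<^sub>R v) w = a *\<^sub>R C p u w + b *\<^sub>R C p v w \<and>
        C p w (a *\<^sub>R u + b *\<^sub>R v) = a *\<^sub>R C p w u + b *\<^sub>R C p w v) \<and>
     (\<forall>X Y. vector_field S T X \<and> vector_field S T Y \<longrightarrow>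
        (\<forall>p\<in>S. nabla S C X Y p \<in> T p)) \<and>
     (\<forall>X Y. vector_field S T X \<and> vector_field S T Y \<longrightarrow>
        (\<forall>p\<in>S. nabla S C X Y p - nabla S C Y X p = lie_bracket S X Y p)) \<and>
     (\<forall>X Y Z. vector_field S T X \<and> vector_field S T Y \<and> vector_field S T Z \<longrightarrow>
        (\<forall>p\<in>S. dderiv (\<lambda>q. g q (Y q) (Z q)) S p (X p) =
                g p (nabla S C X Y p) (Z p) + g p (Y p) (nabla S C X Z p)))"

definition levi_civita ::
  "'a::euclidean_space set \<Rightarrow> ('a \<Rightarrow> 'a set) \<Rightarrow> ('a \<Rightarrow> 'a \<Rightarrow> 'a \<Rightarrow> real) \<Rightarrow>
     'a \<Rightarrow> 'a \<Rightarrow> 'a \<Rightarrow> 'a" where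
  "levi_civita S T g = (SOME C. is_levi_civita S T g C)"

definition is_isometry ::
  "'a::euclidean_space set \<Rightarrow> ('a \<Rightarrow> 'a set) \<Rightarrow> ('a \<Rightarrow> 'a \<Rightarrow> 'a \<Rightarrow> real) \<Rightarrow> ('a \<Rightarrow> 'a) \<Rightarrow> bool" where
  "is_isometry S T g \<Phi> \<longleftrightarrow>
     bij_betw \<Phi> S S \<and> smooth_on S \<Phi> \<and> smooth_on S (inv_into S \<Phi>) \<and>
     (\<forall>p\<in>S. \<forall>v\<in>T p. \<forall>w\<in>T p. g (\<Phi> p) (dderiv \<Phi> S p v) (dderiv \<Phi> S p w) = g p v w)"

definition riemann_curvature ::
  "'a::euclidean_space set \<Rightarrow> ('a \<Rightarrow> 'a \<Rightarrow> 'a \<Rightarrow> 'a) \<Rightarrow>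
     ('a \<Rightarrow> 'a) \<Rightarrow> ('a \<Rightarrow> 'a) \<Rightarrow> ('a \<Rightarrow> 'a) \<Rightarrow> 'a \<Rightarrow> 'a" where
  "riemann_curvature S C X Y Z p =
     nabla S C X (nabla S C Y Z) p - nabla S C Y (nabla S C X Z) p
       - nabla S C (lie_bracket S X Y) Z p"

text \<open>Gaussian curvature of a nondegenerate metric \<open>\<gamma>\<close> on an open \<open>U \<subseteq> \<real>\<^sup>2\<close>.\<close>

definition gaussian_curvature ::
  "(real^2) set \<Rightarrow> (real^2 \<Rightarrow> real^2 \<Rightarrow> real^2 \<Rightarrow> real) \<Rightarrow> real^2 \<Rightarrow> real" where
  "gaussian_curvature U \<gamma> q =
     (let C = levi_civita U (\<lambda>_. UNIV) \<gamma>;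
          e1 = axis 1 1; e2 = axis 2 1
      in \<gamma> q (riemann_curvature U C (\<lambda>_. e1) (\<lambda>_. e2) (\<lambda>_. e2) q) e1 /
           (\<gamma> q e1 e1 * \<gamma> q e2 e2 - (\<gamma> q e1 e2)\<^sup>2))"

subsection \<open>Parametrized surfaces in a submanifold\<close>

definition induced_metric ::
  "('a::euclidean_space \<Rightarrow> 'a \<Rightarrow> 'a \<Rightarrow> real) \<Rightarrow> (real^2) set \<Rightarrow> (real^2 \<Rightarrow> 'a) \<Rightarrow>
     real^2 \<Rightarrow> real^2 \<Rightarrow> real^2 \<Rightarrow> real" where
  "induced_metric g U X q a b = g (X q) (dderiv X U q a) (dderiv X U q b)"

text \<open>Pull-back of the connection \<open>nabla S C\<close> to vector fields \<open>W\<close> along a map \<open>X : U \<rightarrow> S\<close>.\<close>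

definition nabla_along ::
  "(real^2) set \<Rightarrow> ('a::euclidean_space \<Rightarrow> 'a \<Rightarrow> 'a \<Rightarrow> 'a) \<Rightarrow> (real^2 \<Rightarrow> 'a) \<Rightarrow>
     (real^2 \<Rightarrow> 'a) \<Rightarrow> real^2 \<Rightarrow> real^2 \<Rightarrow> 'a" where
  "nabla_along U C X W q a = dderiv W U q a + C (X q) (dderiv X U q a) (W q)"

text \<open>For constant \<open>a\<close> and \<open>b\<close>, this is the component normal to the surface of the covariant
  derivative in direction \<open>a\<close> of the tangent field \<open>dX(b)\<close>.\<close>

definition second_fundamental_form ::
  "'a::euclidean_space set \<Rightarrow> ('a \<Rightarrow> 'a set) \<Rightarrow> ('a \<Rightarrow> 'a \<Rightarrow> 'a \<Rightarrow> real) \<Rightarrow>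
     (real^2) set \<Rightarrow> (real^2 \<Rightarrow> 'a) \<Rightarrow> real^2 \<Rightarrow> real^2 \<Rightarrow> real^2 \<Rightarrow> 'a" where
  "second_fundamental_form S T g U X q a b =
     (THE n. n \<in> T (X q) \<and> (\<forall>c. g (X q) n (dderiv X U q c) = 0) \<and>
        (\<exists>c. nabla_along U (levi_civita S T g) X (\<lambda>r. dderiv X U r b) q a = dderiv X U q c + n))"

section \<open>Abstract surfaces\<close>

text \<open>A smooth surface is a topological space with a set of local parametrizations \<open>(U, x)\<close>,
  that is, inverses of charts.\<close>

definition smooth_surface ::
  "'m topology \<Rightarrow> ((real^2) set \<times> (real^2 \<Rightarrow> 'm)) set \<Rightarrow> bool" where
  "smooth_surface M P \<longleftrightarrow>
     Hausdorff_space M \<and> second_countable M \<and>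
     (\<forall>(U, x)\<in>P. open U \<and> openin M (x ` U) \<and> embedding_map (top_of_set U) M x) \<and>
     (\<Union>(U, x)\<in>P. x ` U) = topspace M \<and>
     (\<forall>(U, x)\<in>P. \<forall>(V, y)\<in>P. smooth_on (U \<inter> x -` (y ` V)) (inv_into V y \<circ> x))"

definition immersion_into ::
  "'a::euclidean_space set \<Rightarrow> ((real^2) set \<times> (real^2 \<Rightarrow> 'm)) set \<Rightarrow> ('m \<Rightarrow> 'a) \<Rightarrow> bool" where
  "immersion_into S P F \<longleftrightarrow>
     (\<forall>(U, x)\<in>P. (F \<circ> x) ` U \<subseteq> S \<and> smooth_on U (F \<circ> x) \<and>
        (\<forall>q\<in>U. inj (dderiv (F \<circ> x) U q)))"

section \<open>The nearly Kaehler manifold \<open>SL(2,\<real>) \<times> SL(2,\<real>)\<close>\<close>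

type_synonym mat2 = "real^2^2"

definition SL2xSL2 :: "(mat2 \<times> mat2) set" where
  "SL2xSL2 = {(A, B). det A = 1 \<and> det B = 1}"

definition tangent_SL :: "mat2 \<times> mat2 \<Rightarrow> (mat2 \<times> mat2) set" where
  "tangent_SL = (\<lambda>(A, B). {(A ** \<alpha>, B ** \<beta>) |\<alpha> \<beta>. trace \<alpha> = 0 \<and> trace \<beta> = 0})"

definition tr_form :: "mat2 \<Rightarrow> mat2 \<Rightarrow> real" where
  "tr_form \<alpha> \<beta> = trace (\<alpha> ** \<beta>) / 2"

definition g_SL :: "mat2 \<times> mat2 \<Rightarrow> mat2 \<times> mat2 \<Rightarrow> mat2 \<times> mat2 \<Rightarrow> real" where
  "g_SL = (\<lambda>(A, B) (X, Y) (Z, W).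
     let \<alpha> = matrix_inv A ** X; \<beta> = matrix_inv B ** Y;
         \<gamma> = matrix_inv A ** Z; \<delta> = matrix_inv B ** W
     in 2/3 * (tr_form \<alpha> \<gamma> + tr_form \<beta> \<delta>) - 1/3 * (tr_form \<beta> \<gamma> + tr_form \<alpha> \<delta>))"

definition J_SL :: "mat2 \<times> mat2 \<Rightarrow> mat2 \<times> mat2 \<Rightarrow> mat2 \<times> mat2" where
  "J_SL = (\<lambda>(A, B) (X, Y).
     let \<alpha> = matrix_inv A ** X; \<beta> = matrix_inv B ** Y
     in (1 / sqrt 3) *\<^sub>R (A ** (\<alpha> - 2 *\<^sub>R \<beta>), B ** (2 *\<^sub>R \<alpha> - \<beta>)))"

definition almost_complex_surface ::
  "'m topology \<Rightarrow> ((real^2) set \<times> (real^2 \<Rightarrow> 'm)) set \<Rightarrow> ('m \<Rightarrow> mat2 \<times> mat2) \<Rightarrow> bool" where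
  "almost_complex_surface M P F \<longleftrightarrow>
     smooth_surface M P \<and> connected_space M \<and> immersion_into SL2xSL2 P F \<and>
     (\<forall>(U, x)\<in>P. \<forall>q\<in>U.
        J_SL (F (x q)) ` range (dderiv (F \<circ> x) U q) \<subseteq> range (dderiv (F \<circ> x) U q))"

definition negative_definite_metric ::
  "((real^2) set \<times> (real^2 \<Rightarrow> 'm)) set \<Rightarrow> ('m \<Rightarrow> mat2 \<times> mat2) \<Rightarrow> bool" where
  "negative_definite_metric P F \<longleftrightarrow>
     (\<forall>(U, x)\<in>P. \<forall>q\<in>U. \<forall>a. a \<noteq> 0 \<longrightarrow> induced_metric g_SL U (F \<circ> x) q a a < 0)"

definition totally_geodesic ::
  "((real^2) set \<times> (real^2 \<Rightarrow> 'm)) set \<Rightarrow> ('m \<Rightarrow> mat2 \<times> mat2) \<Rightarrow> bool" where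
  "totally_geodesic P F \<longleftrightarrow>
     (\<forall>(U, x)\<in>P. \<forall>q\<in>U. \<forall>a b.
        second_fundamental_form SL2xSL2 tangent_SL g_SL U (F \<circ> x) q a b = 0)"

definition flat ::
  "((real^2) set \<times> (real^2 \<Rightarrow> 'm)) set \<Rightarrow> ('m \<Rightarrow> mat2 \<times> mat2) \<Rightarrow> bool" where
  "flat P F \<longleftrightarrow>
     (\<forall>(U, x)\<in>P. \<forall>q\<in>U. gaussian_curvature U (induced_metric g_SL U (F \<circ> x)) q = 0)"

definition congruent_to ::
  "'m topology \<Rightarrow> ('m \<Rightarrow> mat2 \<times> mat2) \<Rightarrow> (mat2 \<times> mat2) set \<Rightarrow> bool" where
  "congruent_to M F \<Sigma> \<longleftrightarrow>
     (\<exists>\<Phi>. is_isometry SL2xSL2 tangent_SL g_SL \<Phi> \<and>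
          openin (top_of_set \<Sigma>) (\<Phi> ` F ` topspace M))"

definition rot :: "real \<Rightarrow> mat2" where
  "rot \<theta> = vector [vector [cos \<theta>, sin \<theta>], vector [- sin \<theta>, cos \<theta>]]"

definition flat_immersion :: "real \<times> real \<Rightarrow> mat2 \<times> mat2" where
  "flat_immersion = (\<lambda>(s, t). (rot (1 / sqrt 2 * (sqrt 3 * s - t)), rot (1 / sqrt 2 * (sqrt 3 * s + t))))"

end

theory Submission
  imports Defs
begin

text \<open>The proof has four ingredients.

  \<^bold>\<open>The connection.\<close> Write a tangent vector at \<open>p = (A, B)\<close> as
  \<open>p \<odot> x = (A ** \<alpha>, B ** \<beta>)\<close> with \<open>x = (\<alpha>,
  \<beta>)\<close> a pair of trace-zero matrices. The metric \<open>g0\<close> on such pairs does not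
  depend on \<open>p\<close>, so the Koszul formula on left-invariant fields determines the
  Levi-Civita connection: it is \<open>p \<odot> (D x + conn \<cdot> x)\<close> with an explicit
  bilinear map \<open>conn\<close> (\<open>is_levi_civita_lc_tensor\<close>,
  \<open>levi_civita_SL\<close>).

  \<^bold>\<open>Tangent planes as complex lines.\<close> With \<open>\<zeta>\<close> a primitive cube
  root of unity, \<open>(\<alpha>, \<beta>) \<mapsto> \<alpha> + \<zeta> \<beta>\<close> identifies
  pairs with \<open>sl(2,\<complex>)\<close> and turns \<open>J\<close> into multiplication by
  \<open>\<i>\<close>. The tangent plane of an almost complex surface, translated to the identity, is
  therefore a complex line. Because the induced metric is negative definite, the lower-left entry does
  not vanish on this line, which is thus spanned by the matrix with rows \<open>(u, v)\<close> and
  \<open>(1, -u)\<close> for two complex functions \<open>u\<close> and \<open>v\<close> on the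
  surface.

  \<^bold>\<open>Rigidity.\<close> If the surface is totally geodesic, the covariant derivative of a
  tangent field stays in the line. On a complex line only one of the three brackets that make up
  \<open>conn\<close> survives, and one obtains a first-order system \<open>du = \<theta> f(u,
  v)\<close>, \<open>dv = \<theta> k(u, v)\<close> (\<open>f\<close> and \<open>k\<close> also involve
  the conjugates of \<open>u\<close> and \<open>v\<close>) with a complex 1-form
  \<open>\<theta>\<close> whose values in two independent directions are independent over the reals
  (\<open>uv_derivative\<close>). Equality of mixed second derivatives of \<open>u\<close> and
  \<open>v\<close> is then an algebraic condition on \<open>u\<close> and \<open>v\<close>, a product
  of two factors (\<open>integrability_factorization\<close>); this is the Codazzi equation.
  Negativity makes the first factor nonzero and allows the second one to vanish only if
  \<open>u\<close> and \<open>v\<close> are real (\<open>uv_real\<close>). For real \<open>u\<close>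
  and \<open>v\<close> the right-hand sides of the system are zero, so \<open>u\<close> and
  \<open>v\<close> are locally constant.

  \<^bold>\<open>The torus.\<close> Locally the translated tangent planes are now the pairs of
  multiples of one fixed real matrix \<open>\<xi>\<close> of positive determinant, and \<open>A **
  \<xi> ** A\<^sup>-\<^sup>1\<close>, \<open>B ** \<xi> ** B\<^sup>-\<^sup>1\<close> are constant.
  These data are determined near each point by the immersion, so by connectedness they are the same
  everywhere (\<open>global_torus\<close>): the surface lies in a left translate of the product of two
  copies of the centralizer of \<open>\<xi>\<close>. A left translation followed by a conjugation is
  an isometry and moves this translate to the torus of pairs of rotations, which is the range of the
  given immersion. Finally, an immersion of a surface into a 2-dimensional torus is open
  (\<open>torus_immersion_open_image\<close>).\<close>

section \<open>The metric in the left trivialization\<close>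

text \<open>The adjugate. It inverts matrices of determinant 1, and unlike the inverse it is linear on all of
  the matrix space, so that it can be differentiated in ambient directions.\<close>

definition adj2 :: "mat2 \<Rightarrow> mat2" where
  "adj2 A = trace A *\<^sub>R mat 1 - A"

definition pmult :: "mat2 \<times> mat2 \<Rightarrow> mat2 \<times> mat2 \<Rightarrow> mat2 \<times> mat2"  (infixl \<open>\<odot>\<close> 70) where
  "p \<odot> w = (fst p ** fst w, snd p ** snd w)"

definition padj :: "mat2 \<times> mat2 \<Rightarrow> mat2 \<times> mat2" where
  "padj p = (adj2 (fst p), adj2 (snd p))"

definition sl2_pairs :: "(mat2 \<times> mat2) set" where
  "sl2_pairs = {w. trace (fst w) = 0 \<and> trace (snd w) = 0}"

text \<open>The value of \<open>g_SL\<close> at the identity.\<close>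

definition g0 :: "mat2 \<times> mat2 \<Rightarrow> mat2 \<times> mat2 \<Rightarrow> real" where
  "g0 x y = 2/3 * (tr_form (fst x) (fst y) + tr_form (snd x) (snd y))
            - 1/3 * (tr_form (snd x) (fst y) + tr_form (fst x) (snd y))"

definition commutator :: "mat2 \<Rightarrow> mat2 \<Rightarrow> mat2" where
  "commutator \<alpha> \<beta> = \<alpha> ** \<beta> - \<beta> ** \<alpha>"

text \<open>Solution of the Koszul formula for \<open>g0\<close>: half of the bracket, plus a correction that is
  symmetric in \<open>x\<close> and \<open>y\<close> and comes from the mixed terms of
  \<open>g0\<close>.\<close>

definition conn :: "mat2 \<times> mat2 \<Rightarrow> mat2 \<times> mat2 \<Rightarrow> mat2 \<times> mat2" where
  "conn x y = (let w = (1/6) *\<^sub>R (commutator (fst x) (snd y) - commutator (snd x) (fst y)) in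
     ((1/2) *\<^sub>R commutator (fst x) (fst y) - w, (1/2) *\<^sub>R commutator (snd x) (snd y) + w))"

definition ltriv :: "(mat2 \<times> mat2 \<Rightarrow> mat2 \<times> mat2) \<Rightarrow> mat2 \<times> mat2 \<Rightarrow> mat2 \<times> mat2" where
  "ltriv Y q = padj q \<odot> Y q"

text \<open>If \<open>Y q = q \<odot> y q\<close>, then \<open>D Y = p \<odot> (D y + x \<odot> y)\<close> in
  direction \<open>p \<odot> x\<close>; subtracting \<open>x \<odot> y\<close> leaves \<open>p \<odot>
  (D y + conn x y)\<close> as covariant derivative.\<close>

definition lc_tensor :: "mat2 \<times> mat2 \<Rightarrow> mat2 \<times> mat2 \<Rightarrow> mat2 \<times> mat2 \<Rightarrow> mat2 \<times> mat2" where
  "lc_tensor p v w = p \<odot> (conn (padj p \<odot> v) (padj p \<odot> w) - (padj p \<odot> v) \<odot> (padj p \<odot> w))"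

lemma mult_nth: "((A::mat2) ** B) $ i $ j = A $ i $ 1 * B $ 1 $ j + A $ i $ 2 * B $ 2 $ j"
  by (simp add: matrix_matrix_mult_def sum_2)

lemma trace_nth: "trace (A::mat2) = A $ 1 $ 1 + A $ 2 $ 2"
  by (simp add: trace_def sum_2)

lemma mat2_eq_iff: "(A::mat2) = B \<longleftrightarrow>
    A $ 1 $ 1 = B $ 1 $ 1 \<and> A $ 1 $ 2 = B $ 1 $ 2 \<and> A $ 2 $ 1 = B $ 2 $ 1 \<and> A $ 2 $ 2 = B $ 2 $ 2"
  by (auto simp: vec_eq_iff forall_2)

lemma mat_1_nth: "(mat 1 :: mat2) $ i $ j = (if i = j then 1 else 0)"
  by (simp add: mat_def)

lemmas mat2_simps = mult_nth trace_nth mat2_eq_iff mat_1_nth det_2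

lemma adj2_nth: "adj2 A $ 1 $ 1 = A $ 2 $ 2" "adj2 A $ 1 $ 2 = - A $ 1 $ 2"
    "adj2 A $ 2 $ 1 = - A $ 2 $ 1" "adj2 A $ 2 $ 2 = A $ 1 $ 1"
  by (auto simp: adj2_def mat2_simps)

lemma adj2_mult: "adj2 (A ** B) = adj2 B ** adj2 A"
  by (simp add: mat2_simps adj2_nth algebra_simps)

lemma adj2_trace_0: "trace A = 0 \<Longrightarrow> adj2 A = - A"
  by (simp add: adj2_def)

lemma mult_adj2:
  assumes "det A = 1"
  shows "A ** adj2 A = mat 1" "adj2 A ** A = mat 1"
  using assms by (auto simp: mat2_simps adj2_nth algebra_simps)

lemma matrix_inv_SL2:
  assumes "det A = 1"
  shows "matrix_inv (A::mat2) = adj2 A"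
proof -
  have "A ** matrix_inv A = mat 1 \<and> matrix_inv A ** A = mat 1"
    unfolding matrix_inv_def by (rule someI[of _ "adj2 A"]) (simp add: mult_adj2 assms)
  then have "adj2 A ** (A ** matrix_inv A) = adj2 A"
    by simp
  then show ?thesis
    by (simp add: matrix_mul_assoc mult_adj2[OF assms])
qed

lemma bounded_bilinear_mult: "bounded_bilinear ((**) :: mat2 \<Rightarrow> mat2 \<Rightarrow> mat2)"
proof -
  have "bilinear ((**) :: mat2 \<Rightarrow> mat2 \<Rightarrow> mat2)"
    by (auto simp: bilinear_def mat2_simps algebra_simps intro!: linearI)
  then show ?thesis
    by (simp add: bilinear_conv_bounded_bilinear)
qed

lemma bounded_bilinear_pmult: "bounded_bilinear (\<odot>)"
proof -
  have "bilinear (\<odot>)"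
    by (auto simp: bilinear_def mat2_simps algebra_simps pmult_def prod_eq_iff intro!: linearI)
  then show ?thesis
    by (simp add: bilinear_conv_bounded_bilinear)
qed

lemma bounded_bilinear_g0: "bounded_bilinear g0"
proof -
  have "bilinear g0"
    by (auto simp: bilinear_def mat2_simps field_simps g0_def tr_form_def intro!: linearI)
  then show ?thesis
    by (simp add: bilinear_conv_bounded_bilinear)
qed

lemma bounded_linear_padj: "bounded_linear padj"
  by (intro linear_conv_bounded_linear[THEN iffD1] linearI)
     (auto simp: padj_def mat2_simps adj2_nth prod_eq_iff)

interpretation pmult: bounded_bilinear "(\<odot>)" by (rule bounded_bilinear_pmult)
interpretation g0: bounded_bilinear g0 by (rule bounded_bilinear_g0)

lemma pmult_assoc: "(p \<odot> q) \<odot> r = p \<odot> (q \<odot> r)"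
  by (simp add: pmult_def matrix_mul_assoc)

lemma padj_pmult: "padj (p \<odot> q) = padj q \<odot> padj p"
  by (simp add: padj_def pmult_def adj2_mult)

lemma padj_sl2: "x \<in> sl2_pairs \<Longrightarrow> padj x = - x"
  by (auto simp: padj_def sl2_pairs_def adj2_trace_0 prod_eq_iff)

lemma padj_padj: "padj (padj p) = p"
  by (simp add: padj_def mat2_simps adj2_nth prod_eq_iff)

text \<open>Membership as a linear equation, in a form that survives differentiation.\<close>

lemma sl2_iff: "x \<in> sl2_pairs \<longleftrightarrow> padj x + x = 0"
  by (auto simp: sl2_pairs_def padj_def mat2_simps adj2_nth prod_eq_iff add.commute)

lemma pmult_padj_cancel:
  assumes "p \<in> SL2xSL2"
  shows "p \<odot> (padj p \<odot> v) = v" "padj p \<odot> (p \<odot> v) = v"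
  using assms by (auto simp: SL2xSL2_def pmult_def padj_def matrix_mul_assoc mult_adj2)

lemma pmult_SL: "p \<in> SL2xSL2 \<Longrightarrow> q \<in> SL2xSL2 \<Longrightarrow> p \<odot> q \<in> SL2xSL2"
  by (auto simp: SL2xSL2_def pmult_def det_mul)

lemma g_SL_eq:
  assumes "p \<in> SL2xSL2"
  shows "g_SL p v w = g0 (padj p \<odot> v) (padj p \<odot> w)"
  using assms
  by (auto simp: g_SL_def g0_def SL2xSL2_def pmult_def padj_def matrix_inv_SL2 Let_def split: prod.splits)

lemma tangent_SL_eq: "tangent_SL p = (\<odot>) p ` sl2_pairs"
  by (cases p) (auto simp: tangent_SL_def sl2_pairs_def pmult_def image_def)

lemma tangent_SL_iff:
  assumes "p \<in> SL2xSL2"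
  shows "v \<in> tangent_SL p \<longleftrightarrow> padj p \<odot> v \<in> sl2_pairs"
  unfolding tangent_SL_eq image_iff using pmult_padj_cancel[OF assms] by metis

lemma subspace_sl2: "subspace sl2_pairs"
  by (auto simp: subspace_def sl2_pairs_def trace_nth simp flip: distrib_left)

lemma commutator_nth: "commutator \<alpha> \<beta> $ i $ j = \<alpha> $ i $ 1 * \<beta> $ 1 $ j + \<alpha> $ i $ 2 * \<beta> $ 2 $ j
    - (\<beta> $ i $ 1 * \<alpha> $ 1 $ j + \<beta> $ i $ 2 * \<alpha> $ 2 $ j)"
  by (simp add: commutator_def mult_nth)

lemma conn_sl2: "conn x y \<in> sl2_pairs"
  by (simp add: conn_def sl2_pairs_def Let_def mat2_simps commutator_nth field_simps)

lemma conn_torsion: "conn x y - conn y x = x \<odot> y - y \<odot> x"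
  by (simp add: conn_def Let_def mat2_simps commutator_nth pmult_def prod_eq_iff field_simps)

lemma conn_metric:
  assumes "x \<in> sl2_pairs" "y \<in> sl2_pairs" "z \<in> sl2_pairs"
  shows "g0 (conn x y) z + g0 y (conn x z) = 0"
proof -
  have e: "fst w $ 2 $ 2 = - fst w $ 1 $ 1" "snd w $ 2 $ 2 = - snd w $ 1 $ 1" if "w \<in> sl2_pairs" for w
    using that by (auto simp: sl2_pairs_def trace_nth)
  show ?thesis
    by (simp add: g0_def tr_form_def conn_def Let_def mat2_simps commutator_nth e assms field_simps)
qed

text \<open>Test against the standard basis of trace-zero matrices in either factor: the matrix of
  \<open>g0\<close> in the two factors, with rows \<open>(2, -1)\<close> and \<open>(-1, 2)\<close> up
  to scale, is invertible.\<close>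

lemma g0_nondegenerate:
  assumes "x \<in> sl2_pairs" and "\<And>y. y \<in> sl2_pairs \<Longrightarrow> g0 x y = 0"
  shows "x = 0"
proof -
  obtain a b where x: "x = (a, b)" by fastforce
  define E1 E2 E3 :: mat2 where E: "E1 = vector [vector [1, 0], vector [0, -1]]"
    "E2 = vector [vector [0, 1], vector [0, 0]]" "E3 = vector [vector [0, 0], vector [1, 0]]"
  have m: "(E, 0) \<in> sl2_pairs" "(0, E) \<in> sl2_pairs" if "E \<in> {E1, E2, E3}" for E
    using that by (auto simp: sl2_pairs_def E trace_nth)
  have "g0 x (E, 0) = 0" "g0 x (0, E) = 0" if "E \<in> {E1, E2, E3}" for E
    using assms(2) m[OF that] by auto
  from this[of E1] this[of E2] this[of E3] assms(1) show ?thesis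
    by (simp add: x g0_def tr_form_def sl2_pairs_def mat2_simps E prod_eq_iff)
qed

section \<open>Derivatives along the group\<close>

text \<open>For trace-zero \<open>\<alpha>\<close> one has \<open>det (mat 1 + t *\<^sub>R \<alpha>) = 1 +
  t\<^sup>2 * det \<alpha>\<close>, so rescaling the straight line to determinant 1 does not change
  its velocity at 0.\<close>

lemma SL2_curve:
  fixes A \<alpha> :: mat2
  assumes "det A = 1" "trace \<alpha> = 0"
  obtains c where "c (0::real) = A" "\<And>t. det (c t) = 1" "(c has_vector_derivative A ** \<alpha>) (at 0)"
proof -
  define d where "d = (\<lambda>t::real. 1 + t\<^sup>2 * det \<alpha>)"
  define b where "b = (\<lambda>t. (1 / sqrt (d t)) *\<^sub>R (A + t *\<^sub>R (A ** \<alpha>)))"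
  have contd: "isCont d 0"
    unfolding d_def by (intro continuous_intros)
  have "eventually (\<lambda>t. d t > 0) (nhds 0)"
    using contd unfolding continuous_at by (rule order_tendstoD(1)[OF tendsto_at_iff_tendsto_nhds[THEN iffD1]]) (simp add: d_def)
  then obtain T where T: "open T" "0 \<in> T" "\<And>t. t \<in> T \<Longrightarrow> d t > 0"
    unfolding eventually_nhds by auto
  have detb: "det (b t) = 1" if "d t > 0" for t
  proof -
    have "A + t *\<^sub>R (A ** \<alpha>) = A ** (mat 1 + t *\<^sub>R \<alpha>)"
      by (simp add: mat2_simps algebra_simps)
    then have "det (A + t *\<^sub>R (A ** \<alpha>)) = det A * det (mat 1 + t *\<^sub>R \<alpha>)"
      by (simp add: det_mul)
    also have "\<dots> = d t"
    proof -
      have "\<alpha> $ 2 $ 2 = - \<alpha> $ 1 $ 1"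
        using assms(2) by (simp add: trace_nth)
      then have "det (mat 1 + t *\<^sub>R \<alpha>) = d t"
        by (simp add: d_def det_2 mat_1_nth algebra_simps power2_eq_square)
      then show ?thesis
        by (simp add: assms(1))
    qed
    moreover have "det (r *\<^sub>R M) = r\<^sup>2 * det M" for r and M :: mat2
      by (simp add: det_2 power2_eq_square algebra_simps)
    ultimately have "det (b t) = (1 / sqrt (d t))\<^sup>2 * d t"
      by (simp only: b_def)
    then show ?thesis
      using that by (simp add: power_divide)
  qed
  \<comment> \<open>Away from 0 the rescaling may be impossible; any point of the group serves there.\<close>
  define c where "c = (\<lambda>t. if d t > 0 then b t else A)"
  have derd: "((\<lambda>t. 1 / sqrt (d t)) has_real_derivative 0) (at 0)"
    unfolding d_def by (auto intro!: derivative_eq_intros)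
  have "(b has_vector_derivative A ** \<alpha>) (at 0)"
    unfolding b_def
    by (auto intro!: derivative_eq_intros derd simp: d_def)
  then have "(c has_vector_derivative A ** \<alpha>) (at 0)"
    by (rule has_vector_derivative_transform_within_open[OF _ T(1,2)]) (use T in \<open>auto simp: c_def\<close>)
  moreover have "c 0 = A"
    by (simp add: c_def b_def d_def)
  ultimately show ?thesis
    using that[of c] detb assms(1) by (auto simp: c_def)
qed

lemma tangent_SL_curve:
  assumes "p \<in> SL2xSL2" "v \<in> tangent_SL p"
  obtains c where "c (0::real) = p" "\<And>t. c t \<in> SL2xSL2" "(c has_vector_derivative v) (at 0)"
proof -
  obtain A B where p: "p = (A, B)" by fastforce
  then obtain \<alpha> \<beta> where v: "v = (A ** \<alpha>, B ** \<beta>)" and tr: "trace \<alpha> = 0" "trace \<beta> = 0"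
    using assms(2) by (auto simp: tangent_SL_def)
  have d: "det A = 1" "det B = 1"
    using assms(1) by (auto simp: p SL2xSL2_def)
  obtain a where a: "a (0::real) = A" "\<And>t. det (a t) = 1" "(a has_vector_derivative A ** \<alpha>) (at 0)"
    using SL2_curve[OF d(1) tr(1)] by metis
  obtain b where b: "b (0::real) = B" "\<And>t. det (b t) = 1" "(b has_vector_derivative B ** \<beta>) (at 0)"
    using SL2_curve[OF d(2) tr(2)] by metis
  show ?thesis
    using has_vector_derivative_Pair[OF a(3) b(3)] a b
    by (intro that[of "\<lambda>t. (a t, b t)"]) (auto simp: p v SL2xSL2_def)
qed

text \<open>The group has empty interior in the space of matrix pairs, so derivatives within it are not unique.
  On a tangent vector they all agree with the derivative along a curve with this velocity.\<close>

lemma derivative_within_SL_unique: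
  assumes "p \<in> SL2xSL2" "v \<in> tangent_SL p"
    and "(f has_derivative D) (at p within SL2xSL2)" "(f has_derivative D') (at p within SL2xSL2)"
  shows "D v = D' v"
proof -
  obtain c where c: "c (0::real) = p" "\<And>t. c t \<in> SL2xSL2" "(c has_vector_derivative v) (at 0)"
    using tangent_SL_curve[OF assms(1,2)] by metis
  have "((\<lambda>t. f (c t)) has_vector_derivative E v) (at 0)"
    if "(f has_derivative E) (at p within SL2xSL2)" for E
  proof -
    have "(f has_derivative E) (at (c 0) within range c)"
      using that c by (auto intro: has_derivative_subset)
    from has_derivative_in_compose[OF c(3)[unfolded has_vector_derivative_def] this]
    have "((\<lambda>t. f (c t)) has_derivative (\<lambda>t. E (t *\<^sub>R v))) (at 0)" .
    moreover have "E (t *\<^sub>R v) = t *\<^sub>R E v" for t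
      using that by (simp add: has_derivative_def bounded_linear.linear linear_cmul)
    ultimately show ?thesis
      by (simp add: has_vector_derivative_def)
  qed
  from this[OF assms(3)] this[OF assms(4)] show ?thesis
    by (rule vector_derivative_unique_at)
qed

lemma dderiv_SL_eq:
  assumes "p \<in> SL2xSL2" "v \<in> tangent_SL p"
    and "(f has_derivative D) (at p within SL2xSL2)"
  shows "dderiv f SL2xSL2 p v = D v"
proof -
  have "(f has_derivative dderiv f SL2xSL2 p) (at p within SL2xSL2)"
    using assms(3) differentiable_def frechet_derivative_works by blast
  then show ?thesis
    using derivative_within_SL_unique[OF assms(1,2) _ assms(3)] by blast
qed

lemma Ck_const: "Ck k W (\<lambda>_. c)"
  by (induction k arbitrary: c) auto

lemma Ck_bounded_linear:
  assumes "bounded_linear f"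
  shows "Ck k W f"
proof (cases k)
  case 0
  then show ?thesis
    using assms by (simp add: linear_continuous_on)
next
  case (Suc n)
  have "frechet_derivative f (at p) = f" for p
    using bounded_linear.has_derivative[OF assms has_derivative_ident] frechet_derivative_at by metis
  then show ?thesis
    using assms Suc Ck_const by (auto simp: bounded_linear_imp_differentiable)
qed

lemma smooth_on_bounded_linear: "bounded_linear f \<Longrightarrow> smooth_on S f"
  unfolding smooth_on_def by (intro ballI exI[of _ UNIV] exI[of _ f]) (auto simp: Ck_bounded_linear)

lemma smooth_on_differentiable:
  assumes "smooth_on S f" "p \<in> S"
  shows "f differentiable (at p within S)"
proof -
  obtain W h where W: "open W" "p \<in> W" "\<And>k. Ck k W h" "\<And>x. x \<in> W \<inter> S \<Longrightarrow> h x = f x"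
    using assms unfolding smooth_on_def by metis
  have "h differentiable (at p)"
    using W(3)[of "Suc 0"] W(2) by simp
  then obtain D where "(h has_derivative D) (at p within S)"
    unfolding differentiable_def using has_derivative_at_withinI by blast
  moreover obtain e where "e > 0" "ball p e \<subseteq> W"
    using W(1,2) openE by blast
  ultimately have "(f has_derivative D) (at p within S)"
    using has_derivative_transform_within[OF _ _ assms(2), of h D e f] W(4)
    by (auto simp: subset_iff dist_commute)
  then show ?thesis
    by (auto simp: differentiable_def)
qed

text \<open>Product rule for \<open>padj q \<odot> Y q\<close>. Since \<open>padj\<close> is linear and is minus
  the identity on trace-zero pairs, differentiating the first factor in direction \<open>p \<odot>
  x\<close> produces \<open>- x\<close>.\<close>

lemma ltriv_has_derivative:
  assumes "p \<in> SL2xSL2" "vector_field SL2xSL2 tangent_SL Y"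
  obtains D where "(ltriv Y has_derivative D) (at p within SL2xSL2)"
    and "\<And>v. v \<in> tangent_SL p \<Longrightarrow>
          D v = padj p \<odot> dderiv Y SL2xSL2 p v - (padj p \<odot> v) \<odot> ltriv Y p"
    and "\<And>v. v \<in> tangent_SL p \<Longrightarrow> D v \<in> sl2_pairs"
proof -
  let ?S = "SL2xSL2"
  have "Y differentiable (at p within ?S)"
    using assms smooth_on_differentiable by (auto simp: vector_field_def)
  then have Y: "(Y has_derivative dderiv Y ?S p) (at p within ?S)"
    by (simp add: frechet_derivative_works)
  define D where "D = (\<lambda>v. padj p \<odot> dderiv Y ?S p v + padj v \<odot> Y p)"
  have "((\<lambda>q. padj q \<odot> Y q) has_derivative D) (at p within ?S)"
    unfolding D_def
    by (intro pmult.FDERIV bounded_linear.has_derivative[OF bounded_linear_padj] has_derivative_ident Y)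
  then have D: "(ltriv Y has_derivative D) (at p within ?S)"
    unfolding ltriv_def[abs_def] .
  have 1: "D v = padj p \<odot> dderiv Y ?S p v - (padj p \<odot> v) \<odot> ltriv Y p" if v: "v \<in> tangent_SL p" for v
  proof -
    obtain x where x: "v = p \<odot> x" "x \<in> sl2_pairs"
      using v by (auto simp: tangent_SL_eq)
    show ?thesis
      using x by (simp add: D_def ltriv_def padj_pmult padj_sl2 pmult_padj_cancel[OF assms(1)]
          pmult_assoc pmult.minus_left)
  qed
  have 2: "D v \<in> sl2_pairs" if v: "v \<in> tangent_SL p" for v
  proof -
    let ?L = "\<lambda>x. padj x + x"
    have "?L (ltriv Y q) = 0" if "q \<in> ?S" for q
      using assms(2) that by (auto simp: vector_field_def tangent_SL_iff ltriv_def simp flip: sl2_iff)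
    then have "((\<lambda>q. ?L (ltriv Y q)) has_derivative (\<lambda>v. 0)) (at p within ?S)"
      by (intro has_derivative_transform[OF assms(1) _ has_derivative_const[of 0]]) auto
    moreover have "((\<lambda>q. ?L (ltriv Y q)) has_derivative (\<lambda>v. ?L (D v))) (at p within ?S)"
      by (intro has_derivative_add bounded_linear.has_derivative[OF bounded_linear_padj] D)
    ultimately show ?thesis
      using derivative_within_SL_unique[OF assms(1) v] by (simp add: sl2_iff)
  qed
  show ?thesis
    using that D 1 2 by blast
qed

section \<open>The Levi-Civita connection\<close>

lemma vector_field_left_invariant:
  assumes "x \<in> sl2_pairs"
  shows "vector_field SL2xSL2 tangent_SL (\<lambda>q. q \<odot> x)"
  using assms
  by (auto simp: vector_field_def tangent_SL_eq
      intro!: smooth_on_bounded_linear bounded_bilinear.bounded_linear_left[OF bounded_bilinear_pmult])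

lemma nabla_lc_tensor:
  assumes "p \<in> SL2xSL2" "X p \<in> tangent_SL p" "vector_field SL2xSL2 tangent_SL Y"
    and "(ltriv Y has_derivative D) (at p within SL2xSL2)"
  shows "nabla SL2xSL2 lc_tensor X Y p = p \<odot> (D (X p) + conn (padj p \<odot> X p) (padj p \<odot> Y p))"
proof -
  obtain D' where D': "(ltriv Y has_derivative D') (at p within SL2xSL2)"
    "D' (X p) = padj p \<odot> dderiv Y SL2xSL2 p (X p) - (padj p \<odot> X p) \<odot> ltriv Y p"
    using ltriv_has_derivative[OF assms(1,3)] assms(2) by metis
  have "D (X p) = D' (X p)"
    by (rule derivative_within_SL_unique[OF assms(1,2,4) D'(1)])
  then show ?thesis
    by (simp add: D' nabla_def lc_tensor_def ltriv_def pmult.add_right pmult.diff_right pmult_padj_cancel[OF assms(1)])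
qed

lemma bounded_bilinear_conn: "bounded_bilinear conn"
proof -
  have "bilinear conn"
    by (auto simp: bilinear_def conn_def Let_def mat2_simps commutator_nth prod_eq_iff field_simps intro!: linearI)
  then show ?thesis
    by (simp add: bilinear_conv_bounded_bilinear)
qed

interpretation conn: bounded_bilinear conn by (rule bounded_bilinear_conn)

text \<open>In the left trivialization the metric is constant, so compatibility reduces to \<open>conn x\<close>
  being skew for \<open>g0\<close>, and vanishing torsion to \<open>conn_torsion\<close>.\<close>

lemma is_levi_civita_lc_tensor: "is_levi_civita SL2xSL2 tangent_SL g_SL lc_tensor"
  unfolding is_levi_civita_def
proof (intro conjI allI impI ballI)
  fix p u v w :: "mat2 \<times> mat2" and a b :: real
  show "lc_tensor p (a *\<^sub>R u + b *\<^sub>R v) w = a *\<^sub>R lc_tensor p u w + b *\<^sub>R lc_tensor p v w"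
    by (simp add: lc_tensor_def pmult.add_right pmult.add_left pmult.diff_right pmult.scaleR_left
        pmult.scaleR_right conn.add_left conn.add_right conn.scaleR_left conn.scaleR_right algebra_simps)
  show "lc_tensor p w (a *\<^sub>R u + b *\<^sub>R v) = a *\<^sub>R lc_tensor p w u + b *\<^sub>R lc_tensor p w v"
    by (simp add: lc_tensor_def pmult.add_right pmult.add_left pmult.diff_right pmult.scaleR_left
        pmult.scaleR_right conn.add_left conn.add_right conn.scaleR_left conn.scaleR_right algebra_simps)
next
  fix X Y p
  assume XY: "vector_field SL2xSL2 tangent_SL X \<and> vector_field SL2xSL2 tangent_SL Y" and p: "p \<in> SL2xSL2"
  then have Xp: "X p \<in> tangent_SL p"
    by (auto simp: vector_field_def)
  obtain D where D: "(ltriv Y has_derivative D) (at p within SL2xSL2)" "D (X p) \<in> sl2_pairs"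
    using ltriv_has_derivative[OF p] XY Xp by metis
  show "nabla SL2xSL2 lc_tensor X Y p \<in> tangent_SL p"
    using nabla_lc_tensor[where X=X, OF p Xp _ D(1)] XY D(2) subspace_add[OF subspace_sl2] conn_sl2
    by (auto simp: tangent_SL_eq)
next
  fix X Y p
  assume p: "p \<in> SL2xSL2"
  have "conn x y - x \<odot> y = conn y x - y \<odot> x" for x y
    using conn_torsion[of x y] by (simp add: algebra_simps)
  then have "lc_tensor p (X p) (Y p) = lc_tensor p (Y p) (X p)"
    unfolding lc_tensor_def by metis
  then show "nabla SL2xSL2 lc_tensor X Y p - nabla SL2xSL2 lc_tensor Y X p = lie_bracket SL2xSL2 X Y p"
    by (simp add: nabla_def lie_bracket_def)
next
  fix X Y Z p
  assume XYZ: "vector_field SL2xSL2 tangent_SL X \<and> vector_field SL2xSL2 tangent_SL Y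
      \<and> vector_field SL2xSL2 tangent_SL Z" and p: "p \<in> SL2xSL2"
  then have T: "X p \<in> tangent_SL p" "Y p \<in> tangent_SL p" "Z p \<in> tangent_SL p"
    by (auto simp: vector_field_def)
  obtain D where D: "(ltriv Y has_derivative D) (at p within SL2xSL2)"
    using ltriv_has_derivative[OF p] XYZ by metis
  obtain E where E: "(ltriv Z has_derivative E) (at p within SL2xSL2)"
    using ltriv_has_derivative[OF p] XYZ by metis
  have "((\<lambda>q. g0 (ltriv Y q) (ltriv Z q)) has_derivative (\<lambda>v. g0 (ltriv Y p) (E v) + g0 (D v) (ltriv Z p)))
      (at p within SL2xSL2)"
    by (rule g0.FDERIV[OF D E])
  then have "((\<lambda>q. g_SL q (Y q) (Z q)) has_derivative (\<lambda>v. g0 (ltriv Y p) (E v) + g0 (D v) (ltriv Z p)))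
      (at p within SL2xSL2)"
    by (rule has_derivative_transform[OF p, rotated]) (simp add: g_SL_eq ltriv_def)
  then have "dderiv (\<lambda>q. g_SL q (Y q) (Z q)) SL2xSL2 p (X p) =
      g0 (ltriv Y p) (E (X p)) + g0 (D (X p)) (ltriv Z p)"
    by (rule dderiv_SL_eq[OF p T(1)])
  moreover have "g0 (conn (padj p \<odot> X p) (padj p \<odot> Y p)) (padj p \<odot> Z p) +
      g0 (padj p \<odot> Y p) (conn (padj p \<odot> X p) (padj p \<odot> Z p)) = 0"
    using T by (intro conn_metric) (simp_all add: tangent_SL_iff[OF p])
  ultimately show "dderiv (\<lambda>q. g_SL q (Y q) (Z q)) SL2xSL2 p (X p) =
      g_SL p (nabla SL2xSL2 lc_tensor X Y p) (Z p) + g_SL p (Y p) (nabla SL2xSL2 lc_tensor X Z p)"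
    using XYZ by (simp add: nabla_lc_tensor[where X=X, OF p T(1) _ D] nabla_lc_tensor[where X=X, OF p T(1) _ E] g_SL_eq[OF p]
        pmult_padj_cancel[OF p] g0.add_left g0.add_right ltriv_def)
qed

text \<open>Koszul's argument on left-invariant fields: the difference of two candidates is symmetric because of
  the torsion condition and skew because of metric compatibility, and a trilinear form that is
  symmetric in one pair of arguments and skew in another vanishes.\<close>

lemma levi_civita_unique:
  assumes C: "is_levi_civita SL2xSL2 tangent_SL g_SL C"
    and p: "p \<in> SL2xSL2" and v: "v \<in> tangent_SL p" and w: "w \<in> tangent_SL p"
  shows "C p v w = lc_tensor p v w"
proof -
  let ?S = "SL2xSL2" and ?X = "\<lambda>x q::mat2\<times>mat2. q \<odot> x"
  have ab: "bounded_linear (?X x)" for x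
    by (rule pmult.bounded_linear_left)
  have dX: "dderiv (?X y) ?S p (p \<odot> x) = p \<odot> x \<odot> y" if "x \<in> sl2_pairs" for x y
    using that by (intro dderiv_SL_eq[OF p _ bounded_linear.has_derivative[OF ab has_derivative_ident]])
       (auto simp: tangent_SL_eq)
  define B where "B x y = padj p \<odot> nabla ?S C (?X x) (?X y) p" for x y
  have Bn: "p \<odot> B x y = nabla ?S C (?X x) (?X y) p" for x y
    by (simp add: B_def pmult_padj_cancel[OF p])
  note vf = vector_field_left_invariant
  have B_sl2: "B x y \<in> sl2_pairs" if "x \<in> sl2_pairs" "y \<in> sl2_pairs" for x y
    using C vf[OF that(1)] vf[OF that(2)] p unfolding is_levi_civita_def B_def
    by (auto simp flip: tangent_SL_iff[OF p])
  have B_torsion: "B x y - B y x = x \<odot> y - y \<odot> x" if "x \<in> sl2_pairs" "y \<in> sl2_pairs" for x y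
  proof -
    have "nabla ?S C (?X x) (?X y) p - nabla ?S C (?X y) (?X x) p = lie_bracket ?S (?X x) (?X y) p"
      using C vf[OF that(1)] vf[OF that(2)] p unfolding is_levi_civita_def by blast
    also have "\<dots> = p \<odot> (x \<odot> y - y \<odot> x)"
      using that by (simp add: lie_bracket_def dX pmult_assoc pmult.diff_right)
    finally show ?thesis
      by (simp add: B_def pmult_padj_cancel[OF p] flip: pmult.diff_right)
  qed
  have B_metric: "g0 (B x y) z + g0 y (B x z) = 0"
    if "x \<in> sl2_pairs" "y \<in> sl2_pairs" "z \<in> sl2_pairs" for x y z
  proof -
    have "((\<lambda>q. g_SL q (?X y q) (?X z q)) has_derivative (\<lambda>_. 0)) (at p within ?S)"
      by (rule has_derivative_transform[OF p _ has_derivative_const[of "g0 y z"]])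
         (simp add: g_SL_eq pmult_padj_cancel)
    then have "dderiv (\<lambda>q. g_SL q (?X y q) (?X z q)) ?S p (?X x p) = 0"
      by (rule dderiv_SL_eq[OF p, rotated]) (use that in \<open>simp add: tangent_SL_eq\<close>)
    moreover have "dderiv (\<lambda>q. g_SL q (?X y q) (?X z q)) ?S p (?X x p) =
        g_SL p (nabla ?S C (?X x) (?X y) p) (?X z p) + g_SL p (?X y p) (nabla ?S C (?X x) (?X z) p)"
      using C vf[OF that(1)] vf[OF that(2)] vf[OF that(3)] p unfolding is_levi_civita_def by blast
    ultimately show ?thesis
      by (simp add: g_SL_eq[OF p] pmult_padj_cancel[OF p] B_def)
  qed
  define D where "D x y = B x y - conn x y" for x y
  have D_sl2: "D x y \<in> sl2_pairs" if "x \<in> sl2_pairs" "y \<in> sl2_pairs" for x y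
    unfolding D_def by (intro subspace_diff[OF subspace_sl2] B_sl2 conn_sl2 that)
  have D_sym: "D x y = D y x" if "x \<in> sl2_pairs" "y \<in> sl2_pairs" for x y
  proof -
    have "D x y - D y x = (B x y - B y x) - (conn x y - conn y x)"
      by (simp add: D_def)
    then show ?thesis
      by (simp add: B_torsion[OF that] conn_torsion)
  qed
  have D_skew: "g0 (D x y) z = - g0 (D x z) y"
    if "x \<in> sl2_pairs" "y \<in> sl2_pairs" "z \<in> sl2_pairs" for x y z
  proof -
    have "g0 a b = g0 b a" for a b
      by (simp add: g0_def tr_form_def mat2_simps algebra_simps)
    then show ?thesis
      using B_metric[OF that] conn_metric[OF that] unfolding D_def
      by (simp add: g0.diff_left g0.diff_right)
  qed
  have D_0: "D x y = 0" if xy: "x \<in> sl2_pairs" "y \<in> sl2_pairs" for x y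
  proof (rule g0_nondegenerate[OF D_sl2[OF xy]])
    fix z assume z: "z \<in> sl2_pairs"
    have "g0 (D x y) z = - g0 (D z x) y"
      using D_skew xy z D_sym by metis
    also have "\<dots> = g0 (D y z) x"
      using D_skew xy z D_sym by (metis minus_equation_iff)
    also have "\<dots> = - g0 (D x y) z"
      using D_skew xy z D_sym by metis
    finally show "g0 (D x y) z = 0" by simp
  qed
  obtain x y where xy: "x \<in> sl2_pairs" "y \<in> sl2_pairs" "v = p \<odot> x" "w = p \<odot> y"
    using v w by (auto simp: tangent_SL_eq)
  have "p \<odot> conn x y = p \<odot> x \<odot> y + C p v w"
    using D_0[OF xy(1,2)] Bn[of x y] xy(1) by (simp add: D_def nabla_def dX xy)
  then show ?thesis
    by (simp add: lc_tensor_def xy pmult_padj_cancel[OF p] pmult.diff_right pmult_assoc)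
qed

text \<open>The choice operator in \<open>levi_civita\<close> does pick a Levi-Civita connection, because one
  exists.\<close>

lemma levi_civita_SL:
  assumes "p \<in> SL2xSL2" "v \<in> tangent_SL p" "w \<in> tangent_SL p"
  shows "levi_civita SL2xSL2 tangent_SL g_SL p v w = lc_tensor p v w"
  using levi_civita_unique[OF _ assms] someI[of "is_levi_civita SL2xSL2 tangent_SL g_SL", OF is_levi_civita_lc_tensor]
  unfolding levi_civita_def by blast

section \<open>Symmetry of second derivatives\<close>

text \<open>The mean value theorem, applied to the first difference in direction \<open>b\<close> as a function
  of the parameter along \<open>a\<close>, expresses the second difference through \<open>D \<cdot>
  a\<close> at two nearby points, where differentiability of \<open>D \<cdot> a\<close> at
  \<open>q\<close> applies.\<close>

lemma second_difference_estimate: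
  fixes f :: "'a::real_normed_vector \<Rightarrow> real"
  assumes "open U" "q \<in> U" "\<And>p. p \<in> U \<Longrightarrow> (f has_derivative D p) (at p)"
    and Da: "((\<lambda>p. D p a) has_derivative Da) (at q)" and "e > 0"
  shows "\<exists>d>0. \<forall>t. 0 < t \<and> t < d \<longrightarrow>
    \<bar>f (q + t *\<^sub>R a + t *\<^sub>R b) - f (q + t *\<^sub>R a) - f (q + t *\<^sub>R b) + f q - t\<^sup>2 * Da b\<bar>
      \<le> e * t\<^sup>2 * (2 * norm a + norm b)"
proof -
  obtain r1 where r1: "r1 > 0" "ball q r1 \<subseteq> U"
    using assms(1,2) openE by blast
  obtain r2 where r2: "r2 > 0" "\<And>p. norm (p - q) < r2 \<Longrightarrow> norm (D p a - D q a - Da (p - q)) \<le> e * norm (p - q)"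
    using Da \<open>e > 0\<close> unfolding has_derivative_at_alt by blast
  define r where "r = min r1 r2"
  define d where "d = r / (norm a + norm b + 1)"
  have "d > 0"
    using r1 r2 by (auto simp: d_def r_def intro!: divide_pos_pos add_nonneg_pos)
  moreover have "\<bar>f (q + t *\<^sub>R a + t *\<^sub>R b) - f (q + t *\<^sub>R a) - f (q + t *\<^sub>R b) + f q - t\<^sup>2 * Da b\<bar>
      \<le> e * t\<^sup>2 * (2 * norm a + norm b)" if t: "0 < t" "t < d" for t
  proof -
    have small: "norm (s *\<^sub>R a + s' *\<^sub>R b) < r" if "0 \<le> s" "s \<le> t" "0 \<le> s'" "s' \<le> t" for s s'
    proof -
      have "norm (s *\<^sub>R a + s' *\<^sub>R b) \<le> s * norm a + s' * norm b"
        using norm_triangle_ineq[of "s *\<^sub>R a" "s' *\<^sub>R b"] that by simp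
      also have "\<dots> \<le> t * norm a + t * norm b"
        using that by (intro add_mono mult_right_mono) auto
      also have "\<dots> \<le> t * (norm a + norm b + 1)"
        using t by (simp add: algebra_simps)
      also have "\<dots> < d * (norm a + norm b + 1)"
        using t by (intro mult_strict_right_mono) (auto intro: add_nonneg_pos)
      also have "\<dots> = r"
        using norm_ge_zero[of a] norm_ge_zero[of b] unfolding d_def
        by (smt (verit) norm_ge_zero nonzero_eq_divide_eq)
      finally show ?thesis .
    qed
    define \<phi> where "\<phi> s = f (q + s *\<^sub>R a + t *\<^sub>R b) - f (q + s *\<^sub>R a)" for s
    have mem: "q + x \<in> U" if "norm x < r" for x
      using subsetD[OF r1(2), of "q + x"] that by (simp add: dist_norm r_def)
    have inU: "q + s *\<^sub>R a + t *\<^sub>R b \<in> U" "q + s *\<^sub>R a \<in> U" if "0 \<le> s" "s \<le> t" for s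
      using mem[OF small, of s t] mem[OF small, of s 0] that t by (auto simp: add.assoc)
    have der: "(\<phi> has_real_derivative D (q + s *\<^sub>R a + t *\<^sub>R b) a - D (q + s *\<^sub>R a) a) (at s)"
      if s: "0 \<le> s" "s \<le> t" for s
    proof -
      have lin: "linear (D p)" if "p \<in> U" for p
        using assms(3)[OF that] has_derivative_linear by blast
      have "((\<lambda>s. f (q + s *\<^sub>R a + t *\<^sub>R b)) has_derivative (\<lambda>h. D (q + s *\<^sub>R a + t *\<^sub>R b) (h *\<^sub>R a))) (at s)"
        by (rule has_derivative_compose[OF _ assms(3)]) (use inU[OF s] in \<open>auto intro!: derivative_eq_intros\<close>)
      moreover have "((\<lambda>s. f (q + s *\<^sub>R a)) has_derivative (\<lambda>h. D (q + s *\<^sub>R a) (h *\<^sub>R a))) (at s)"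
        by (rule has_derivative_compose[OF _ assms(3)]) (use inU[OF s] in \<open>auto intro!: derivative_eq_intros\<close>)
      ultimately have "(\<phi> has_derivative (\<lambda>h. D (q + s *\<^sub>R a + t *\<^sub>R b) (h *\<^sub>R a) - D (q + s *\<^sub>R a) (h *\<^sub>R a))) (at s)"
        unfolding \<phi>_def by (rule has_derivative_diff)
      moreover have "D (q + s *\<^sub>R a + t *\<^sub>R b) (h *\<^sub>R a) - D (q + s *\<^sub>R a) (h *\<^sub>R a)
          = (D (q + s *\<^sub>R a + t *\<^sub>R b) a - D (q + s *\<^sub>R a) a) * h" for h
        unfolding linear_cmul[OF lin[OF inU(1)[OF s]]] linear_cmul[OF lin[OF inU(2)[OF s]]]
        by (simp add: right_diff_distrib mult.commute)
      ultimately show ?thesis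
        by (simp only: has_field_derivative_def)
    qed
    obtain s where s: "0 < s" "s < t"
      "\<phi> t - \<phi> 0 = (t - 0) * (D (q + s *\<^sub>R a + t *\<^sub>R b) a - D (q + s *\<^sub>R a) a)"
      using MVT2[OF t(1) der] by blast
    let ?x = "s *\<^sub>R a + t *\<^sub>R b" and ?y = "s *\<^sub>R a"
    have x: "\<bar>D (q + ?x) a - D q a - Da ?x\<bar> \<le> e * norm ?x"
      using r2(2)[of "q + ?x"] small[of s t] s t by (simp add: r_def)
    have y: "\<bar>D (q + ?y) a - D q a - Da ?y\<bar> \<le> e * norm ?y"
      using r2(2)[of "q + ?y"] small[of s 0] s t by (simp add: r_def)
    have "Da ?x - Da ?y = t * Da b"
      using has_derivative_linear[OF Da] by (simp add: linear_add linear_cmul)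
    then have "\<bar>(D (q + ?x) a - D (q + ?y) a) - t * Da b\<bar> \<le> e * (norm ?x + norm ?y)"
      using x y by (simp add: algebra_simps)
    also have "\<dots> \<le> e * (t * (2 * norm a + norm b))"
    proof (rule mult_left_mono)
      have "norm ?x + norm ?y \<le> (s * norm a + t * norm b) + s * norm a"
        using norm_triangle_ineq[of "s *\<^sub>R a" "t *\<^sub>R b"] s t by simp
      also have "\<dots> \<le> (t * norm a + t * norm b) + t * norm a"
        using s by (intro add_mono mult_right_mono) auto
      finally show "norm ?x + norm ?y \<le> t * (2 * norm a + norm b)"
        by (simp add: algebra_simps)
    qed (use \<open>e > 0\<close> in simp)
    finally have *: "\<bar>(D (q + ?x) a - D (q + ?y) a) - t * Da b\<bar> \<le> e * (t * (2 * norm a + norm b))" .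
    have "f (q + t *\<^sub>R a + t *\<^sub>R b) - f (q + t *\<^sub>R a) - f (q + t *\<^sub>R b) + f q - t\<^sup>2 * Da b
        = t * ((D (q + ?x) a - D (q + ?y) a) - t * Da b)"
      using s(3) by (simp add: \<phi>_def power2_eq_square algebra_simps)
    also have "\<bar>\<dots>\<bar> \<le> t * (e * (t * (2 * norm a + norm b)))"
      using mult_left_mono[OF *, of t] t by (simp add: abs_mult)
    finally show ?thesis
      by (simp add: power2_eq_square algebra_simps)
  qed
  ultimately show ?thesis by blast
qed

text \<open>The second difference is symmetric in \<open>a\<close> and \<open>b\<close>, and divided by
  \<open>t\<^sup>2\<close> it tends to both mixed derivatives.\<close>

lemma symmetric_second_derivative_real:
  fixes f :: "'a::real_normed_vector \<Rightarrow> real"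
  assumes "open U" "q \<in> U" "\<And>p. p \<in> U \<Longrightarrow> (f has_derivative D p) (at p)"
    and "((\<lambda>p. D p a) has_derivative Da) (at q)" "((\<lambda>p. D p b) has_derivative Db) (at q)"
  shows "Da b = Db a"
proof (rule ccontr)
  assume "Da b \<noteq> Db a"
  define K where "K = 3 * norm a + 3 * norm b + 1"
  have K: "K > 0" by (simp add: K_def add_nonneg_pos)
  define e where "e = \<bar>Da b - Db a\<bar> / (2 * K)"
  have e: "e > 0" using K \<open>Da b \<noteq> Db a\<close> by (simp add: e_def)
  obtain d1 where d1: "d1 > 0" "\<And>t. 0 < t \<Longrightarrow> t < d1 \<Longrightarrow>
      \<bar>f (q + t *\<^sub>R a + t *\<^sub>R b) - f (q + t *\<^sub>R a) - f (q + t *\<^sub>R b) + f q - t\<^sup>2 * Da b\<bar>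
      \<le> e * t\<^sup>2 * (2 * norm a + norm b)"
    using second_difference_estimate[OF assms(1-4) e, of b] by blast
  obtain d2 where d2: "d2 > 0" "\<And>t. 0 < t \<Longrightarrow> t < d2 \<Longrightarrow>
      \<bar>f (q + t *\<^sub>R b + t *\<^sub>R a) - f (q + t *\<^sub>R b) - f (q + t *\<^sub>R a) + f q - t\<^sup>2 * Db a\<bar>
      \<le> e * t\<^sup>2 * (2 * norm b + norm a)"
    using second_difference_estimate[OF assms(1-3,5) e, of a] by blast
  obtain t where t: "0 < t" "t < d1" "t < d2"
    using d1(1) d2(1) by (meson dense min_less_iff_conj)
  have "q + t *\<^sub>R b + t *\<^sub>R a = q + t *\<^sub>R a + t *\<^sub>R b"
    by (simp add: algebra_simps)
  then have "\<bar>t\<^sup>2 * Da b - t\<^sup>2 * Db a\<bar> \<le> e * t\<^sup>2 * (2 * norm a + norm b) + e * t\<^sup>2 * (2 * norm b + norm a)"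
    using d1(2)[OF t(1,2)] d2(2)[OF t(1,3)] by (smt (verit))
  also have "\<dots> = t\<^sup>2 * (e * (K - 1))"
    by (simp add: K_def algebra_simps)
  finally have "t\<^sup>2 * \<bar>Da b - Db a\<bar> \<le> t\<^sup>2 * (e * (K - 1))"
    by (simp add: abs_mult flip: right_diff_distrib)
  then have "\<bar>Da b - Db a\<bar> \<le> e * (K - 1)"
    using t by simp
  also have "\<dots> < e * (2 * K)"
    using e K by simp
  finally show False
    using K by (simp add: e_def)
qed

lemma symmetric_second_derivative:
  fixes f :: "'a::real_normed_vector \<Rightarrow> 'b::real_inner"
  assumes "open U" "q \<in> U" "\<And>p. p \<in> U \<Longrightarrow> (f has_derivative D p) (at p)"
    and "((\<lambda>p. D p a) has_derivative Da) (at q)" "((\<lambda>p. D p b) has_derivative Db) (at q)"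
  shows "Da b = Db a"
proof -
  define w where "w = Da b - Db a"
  note inner = bounded_linear.has_derivative[OF bounded_linear_inner_right[of w]]
  have "w \<bullet> Da b = w \<bullet> Db a"
    by (rule symmetric_second_derivative_real[OF assms(1,2) inner[OF assms(3)] inner[OF assms(4)] inner[OF assms(5)]])
  then have "w \<bullet> w = 0"
    by (simp add: w_def inner_diff_right)
  then show ?thesis
    by (simp add: w_def)
qed

section \<open>Pairs of matrices as complex matrices\<close>

text \<open>The primitive cube root of unity in the upper half plane.\<close>

definition root3 :: complex where
  "root3 = Complex (-1/2) (sqrt 3 / 2)"

text \<open>Entry of the complex matrix \<open>\<alpha> + \<zeta> \<beta>\<close> attached to the pair
  \<open>(\<alpha>, \<beta>)\<close>, with \<open>\<zeta> = root3\<close>. The cube root of unity is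
  the coefficient for which \<open>J_SL\<close> becomes multiplication by \<open>\<i>\<close>.\<close>

definition cxentry :: "2 \<Rightarrow> 2 \<Rightarrow> mat2 \<times> mat2 \<Rightarrow> complex" where
  "cxentry i j w = of_real (fst w $ i $ j) + root3 * of_real (snd w $ i $ j)"

lemma root3_square: "root3 * root3 = - 1 - root3"
  by (simp add: root3_def complex_eq_iff)

lemma cnj_root3: "cnj root3 = - 1 - root3"
  by (simp add: root3_def complex_eq_iff)

lemma cxentry_linear: "cxentry i j (a + b) = cxentry i j a + cxentry i j b" "cxentry i j (r *\<^sub>R a) = of_real r * cxentry i j a"
   "cxentry i j 0 = 0"
  by (simp_all add: cxentry_def algebra_simps)

lemma bounded_linear_cxentry: "bounded_linear (cxentry i j)"
  by (intro linear_conv_bounded_linear[THEN iffD1] linearI) (simp_all add: cxentry_linear scaleR_conv_of_real)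

lemma cxentry_eq_0: "cxentry i j w = 0 \<longleftrightarrow> fst w $ i $ j = 0 \<and> snd w $ i $ j = 0"
  by (auto simp: cxentry_def root3_def complex_eq_iff)

lemma J_SL_cxentry:
  assumes "p \<in> SL2xSL2"
  shows "cxentry i j (padj p \<odot> J_SL p (p \<odot> x)) = \<i> * cxentry i j x"
proof -
  obtain A B where p: "p = (A, B)" by fastforce
  have d: "det A = 1" "det B = 1" using assms by (auto simp: p SL2xSL2_def)
  obtain \<alpha> \<beta> where x: "x = (\<alpha>, \<beta>)" by fastforce
  have J: "padj p \<odot> J_SL p (p \<odot> x) = (1 / sqrt 3) *\<^sub>R (\<alpha> - 2 *\<^sub>R \<beta>, 2 *\<^sub>R \<alpha> - \<beta>)"
    using d by (simp add: J_SL_def p x pmult_def padj_def Let_def matrix_inv_SL2 matrix_mul_assoc mult_adj2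
        bounded_bilinear.scaleR_right[OF bounded_bilinear_mult])
  have s: "sqrt 3 * (sqrt 3 * r) = 3 * r" for r
    by (simp flip: mult.assoc)
  show ?thesis
    unfolding J by (simp add: cxentry_def x root3_def complex_eq_iff field_simps s)
qed

text \<open>Write \<open>z\<close>, \<open>z'\<close> for the complex matrices of \<open>x\<close>,
  \<open>y\<close>, a bar for entrywise conjugation and \<open>\<zeta> = root3\<close>. Then \<open>6
  conn = - 2 \<zeta> [z, z'] + [bar z, bar z'] + 2 (1 + \<zeta>) [bar z, z']\<close>. If both matrices
  are multiples \<open>a Y\<close>, \<open>b Y\<close> of the same \<open>Y\<close>, with rows
  \<open>(u, v)\<close> and \<open>(1, -u)\<close>, the first two brackets vanish and \<open>cnj a *
  b\<close> times the bracket of \<open>bar Y\<close> and \<open>Y\<close> remains.\<close>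

lemma conn_complex_line:
  assumes x: "x \<in> sl2_pairs" "cxentry 1 1 x = u * a" "cxentry 1 2 x = v * a" "cxentry 2 1 x = a"
    and y: "y \<in> sl2_pairs" "cxentry 1 1 y = u * b" "cxentry 1 2 y = v * b" "cxentry 2 1 y = b"
  shows "3 * cxentry 1 1 (conn x y) = (1 + root3) * cnj a * b * (cnj v - v)"
    and "3 * cxentry 1 2 (conn x y) = (1 + root3) * cnj a * b * (2 * (cnj u * v - u * cnj v))"
    and "3 * cxentry 2 1 (conn x y) = (1 + root3) * cnj a * b * (2 * (u - cnj u))"
proof -
  have t: "snd w $ 2 $ 2 = - snd w $ 1 $ 1" "fst w $ 2 $ 2 = - fst w $ 1 $ 1" if "w \<in> sl2_pairs" for w
    using that by (auto simp: sl2_pairs_def trace_nth)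
  define z where "z i j = cxentry i j x" for i j
  define z' where "z' i j = cxentry i j y" for i j
  have six: "6 * cxentry i j (conn x y) =
      of_real (3 * commutator (fst x) (fst y) $ i $ j - commutator (fst x) (snd y) $ i $ j + commutator (snd x) (fst y) $ i $ j) +
      root3 * of_real (3 * commutator (snd x) (snd y) $ i $ j + commutator (fst x) (snd y) $ i $ j - commutator (snd x) (fst y) $ i $ j)"
    for i j
    by (simp add: cxentry_def conn_def Let_def algebra_simps)
  have root3_cancel: "root3 * (root3 * r) = - r - root3 * r" for r
    unfolding mult.assoc[symmetric] root3_square by (simp add: algebra_simps)
  note defs = z_def z'_def cxentry_def commutator_nth t[OF x(1)] t[OF y(1)] cnj_root3
  have 1: "6 * cxentry 1 1 (conn x y) = - 2 * root3 * (z 1 2 * z' 2 1 - z' 1 2 * z 2 1)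
      + cnj (z 1 2) * cnj (z' 2 1) - cnj (z' 1 2) * cnj (z 2 1)
      + 2 * (1 + root3) * (cnj (z 1 2) * z' 2 1 - z' 1 2 * cnj (z 2 1))"
    unfolding six by (simp add: defs algebra_simps root3_square root3_cancel)
  have 2: "6 * cxentry 1 2 (conn x y) = - 2 * root3 * (2 * (z 1 1 * z' 1 2 - z' 1 1 * z 1 2))
      + 2 * (cnj (z 1 1) * cnj (z' 1 2) - cnj (z' 1 1) * cnj (z 1 2))
      + 2 * (1 + root3) * (2 * (cnj (z 1 1) * z' 1 2 - z' 1 1 * cnj (z 1 2)))"
    unfolding six by (simp add: defs algebra_simps root3_square root3_cancel)
  have 3: "6 * cxentry 2 1 (conn x y) = - 2 * root3 * (2 * (z 2 1 * z' 1 1 - z' 2 1 * z 1 1))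
      + 2 * (cnj (z 2 1) * cnj (z' 1 1) - cnj (z' 2 1) * cnj (z 1 1))
      + 2 * (1 + root3) * (2 * (cnj (z 2 1) * z' 1 1 - z' 2 1 * cnj (z 1 1)))"
    unfolding six by (simp add: defs algebra_simps root3_square root3_cancel)
  note e = z_def z'_def x y
  have "6 * cxentry 1 1 (conn x y) = 2 * ((1 + root3) * cnj a * b * (cnj v - v))"
    unfolding 1 by (simp add: e algebra_simps)
  then show "3 * cxentry 1 1 (conn x y) = (1 + root3) * cnj a * b * (cnj v - v)" by simp
  have "6 * cxentry 1 2 (conn x y) = 2 * ((1 + root3) * cnj a * b * (2 * (cnj u * v - u * cnj v)))"
    unfolding 2 by (simp add: e algebra_simps)
  then show "3 * cxentry 1 2 (conn x y) = (1 + root3) * cnj a * b * (2 * (cnj u * v - u * cnj v))" by simp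
  have "6 * cxentry 2 1 (conn x y) = 2 * ((1 + root3) * cnj a * b * (2 * (u - cnj u)))"
    unfolding 3 by (simp add: e algebra_simps)
  then show "3 * cxentry 2 1 (conn x y) = (1 + root3) * cnj a * b * (2 * (u - cnj u))" by simp
qed

text \<open>\<open>g0\<close> is two thirds of the Hermitian form obtained from the half trace form on
  \<open>sl(2,\<complex>)\<close>.\<close>

lemma g0_cxentry:
  assumes "x \<in> sl2_pairs"
  shows "g0 x x = 2/3 * ((cmod (cxentry 1 1 x))\<^sup>2 + Re (cxentry 1 2 x * cnj (cxentry 2 1 x)))"
proof -
  have t: "snd x $ 2 $ 2 = - snd x $ 1 $ 1" "fst x $ 2 $ 2 = - fst x $ 1 $ 1"
    using assms by (auto simp: sl2_pairs_def trace_nth)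
  have s: "sqrt 3 * (sqrt 3 * r) = 3 * r" for r
    by (simp flip: mult.assoc)
  show ?thesis
    unfolding cmod_power2
    by (simp add: g0_def tr_form_def mat2_simps t cxentry_def root3_def field_simps power2_eq_square s)
qed

text \<open>Here \<open>f\<close> and \<open>k\<close> are the right-hand sides of the system for \<open>(u,
  v)\<close>. The left-hand side is what equality of mixed derivatives forces to vanish. With
  \<open>Y\<close> the matrix with rows \<open>(u, v)\<close> and \<open>(1, -u)\<close> and
  \<open>N\<close> the bracket of its conjugate with it, the factors on the right are the half trace
  forms \<open>\<langle>Y, Y\<rangle>\<close> and \<open>\<langle>N, N\<rangle>\<close>, up to a
  constant.\<close>

lemma integrability_factorization:
  fixes u v :: complex
  defines "f \<equiv> cnj v - v - 2 * (u - cnj u) * u"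
    and "k \<equiv> 2 * (cnj u * v - u * cnj v) - 2 * (u - cnj u) * v"
  shows "cnj k * k + 2 * u * cnj f * k + 2 * u * cnj k * f - 4 * v * cnj f * f =
    4 * (u\<^sup>2 + v) * ((cnj v - v)\<^sup>2 + 4 * (cnj u * v - u * cnj v) * (u - cnj u))"
  unfolding f_def k_def by (simp add: algebra_simps power2_eq_square)

text \<open>The half trace form has only one negative direction. If the Hermitian form is negative on the line,
  then the line cannot be isotropic, which excludes the first factor. The second factor vanishes only
  if the real and imaginary parts of a spanning matrix span a degenerate plane or a line; a plane that
  contains a negative vector is nondegenerate, so they span a line. As the lower-left entry is 1, the
  imaginary part is then zero.\<close>

lemma negative_line_real:
  fixes u v :: complex
  assumes neg: "(cmod u)\<^sup>2 + Re v < 0"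
    and eq: "(u\<^sup>2 + v) * ((cnj v - v)\<^sup>2 + 4 * (cnj u * v - u * cnj v) * (u - cnj u)) = 0"
  shows "Im u = 0" "Im v = 0"
proof -
  obtain a b where u: "u = Complex a b" by (cases u)
  obtain c d where v: "v = Complex c d" by (cases v)
  have n: "a\<^sup>2 + b\<^sup>2 + c < 0"
    using neg unfolding cmod_power2 by (simp add: u v)
  have "Re (u\<^sup>2 + v) < 0"
  proof -
    have "Re (u\<^sup>2 + v) = a\<^sup>2 - b\<^sup>2 + c"
      by (simp add: u v power2_eq_square)
    then show ?thesis
      using n zero_le_power2[of b] by linarith
  qed
  then have "u\<^sup>2 + v \<noteq> 0"
    by (metis less_irrefl zero_complex.simps(1))
  then have "(cnj v - v)\<^sup>2 + 4 * (cnj u * v - u * cnj v) * (u - cnj u) = 0"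
    using eq by simp
  then have "Re ((cnj v - v)\<^sup>2 + 4 * (cnj u * v - u * cnj v) * (u - cnj u)) = 0" by simp
  then have "d\<^sup>2 + 4 * (a * d - b * c) * b = 0"
    by (simp add: u v power2_eq_square algebra_simps)
  then have "(d + 2 * a * b)\<^sup>2 = 4 * b\<^sup>2 * (a\<^sup>2 + c)"
    by (simp add: power2_eq_square algebra_simps)
  moreover have "4 * b\<^sup>2 * (a\<^sup>2 + c) \<le> - 4 * b\<^sup>2 * b\<^sup>2"
  proof -
    have "4 * b\<^sup>2 * (a\<^sup>2 + c) \<le> 4 * b\<^sup>2 * (- b\<^sup>2)"
      using n by (intro mult_left_mono) auto
    then show ?thesis by simp
  qed
  ultimately have "(d + 2 * a * b)\<^sup>2 + 4 * (b\<^sup>2)\<^sup>2 \<le> 0"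
    by (simp add: power2_eq_square)
  then have "(d + 2 * a * b)\<^sup>2 = 0" "(b\<^sup>2)\<^sup>2 = 0"
    using zero_le_power2[of "d + 2 * a * b"] zero_le_power2[of "b\<^sup>2"] by linarith+
  then have "b = 0" "d + 2 * a * b = 0"
    by simp_all
  then show "Im u = 0" "Im v = 0"
    by (auto simp: u v)
qed

section \<open>Totally geodesic negative definite patches\<close>

text \<open>On an open set the local smooth extensions agree with the map itself, so two derivatives exist.\<close>

lemma smooth_on_open_derivatives:
  assumes "open U" "smooth_on U X" "q \<in> U"
  shows "(X has_derivative dderiv X U q) (at q)"
    and "((\<lambda>r. dderiv X U r b) has_derivative dderiv (\<lambda>r. dderiv X U r b) U q) (at q)"
proof -
  obtain W h where W: "open W" "q \<in> W" "\<And>k. Ck k W h" "\<And>x. x \<in> W \<inter> U \<Longrightarrow> h x = X x"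
    using assms unfolding smooth_on_def by metis
  define V where "V = W \<inter> U"
  have V: "open V" "q \<in> V" "V \<subseteq> W" "V \<subseteq> U"
    using W assms by (auto simp: V_def)
  have atU: "at r within U = at r" if "r \<in> U" for r
    using that assms(1) by (rule at_within_open)
  have X: "(X has_derivative frechet_derivative h (at r)) (at r)" if "r \<in> V" for r
  proof -
    have "h differentiable (at r)"
      using W(3)[of "Suc 0"] that V by auto
    then have "(h has_derivative frechet_derivative h (at r)) (at r)"
      by (simp add: frechet_derivative_works)
    then show ?thesis
      by (rule has_derivative_transform_within_open[OF _ V(1) that]) (simp add: W(4) V_def)
  qed
  have eq: "dderiv X U r = frechet_derivative h (at r)" if "r \<in> V" for r
    using frechet_derivative_at[OF X[OF that]] atU[of r] V that by auto
  show "(X has_derivative dderiv X U q) (at q)"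
    using X[OF V(2)] eq[OF V(2)] by simp
  have "(\<lambda>p. frechet_derivative h (at p) b) differentiable (at q)"
    using W(3)[of "Suc (Suc 0)"] V by auto
  then obtain D where "((\<lambda>p. frechet_derivative h (at p) b) has_derivative D) (at q)"
    by (auto simp: differentiable_def)
  then have "((\<lambda>r. dderiv X U r b) has_derivative D) (at q)"
    by (rule has_derivative_transform_within_open[OF _ V(1,2)]) (simp add: eq)
  then have "(\<lambda>r. dderiv X U r b) differentiable (at q)"
    by (auto simp: differentiable_def)
  then show "((\<lambda>r. dderiv X U r b) has_derivative dderiv (\<lambda>r. dderiv X U r b) U q) (at q)"
    by (simp add: frechet_derivative_works atU[OF assms(3)])
qed

text \<open>Differentiate \<open>padj (Y r) \<odot> Y r = 1\<close>.\<close>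

lemma SL_valued_derivative:
  assumes "open U" "q \<in> U" "(Y has_derivative D) (at q)" "\<And>r. r \<in> U \<Longrightarrow> Y r \<in> SL2xSL2"
  shows "padj (Y q) \<odot> D h \<in> sl2_pairs"
proof -
  have "((\<lambda>r. padj (Y r) \<odot> Y r) has_derivative (\<lambda>h. padj (Y q) \<odot> D h + padj (D h) \<odot> Y q)) (at q)"
    by (intro pmult.FDERIV bounded_linear.has_derivative[OF bounded_linear_padj] assms)
  moreover have "((\<lambda>r. padj (Y r) \<odot> Y r) has_derivative (\<lambda>h. 0)) (at q)"
  proof (rule has_derivative_transform_within_open[OF has_derivative_const assms(1,2)])
    show "(mat 1, mat 1) = padj (Y r) \<odot> Y r" if "r \<in> U" for r
      using assms(4)[OF that] by (auto simp: SL2xSL2_def padj_def pmult_def mult_adj2)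
  qed
  ultimately have "(\<lambda>h. padj (Y q) \<odot> D h + padj (D h) \<odot> Y q) = (\<lambda>h. 0)"
    by (rule has_derivative_unique)
  then have "padj (Y q) \<odot> D h + padj (D h) \<odot> Y q = 0"
    by meson
  then show ?thesis
    by (simp add: sl2_iff padj_pmult padj_padj add.commute)
qed

lemma intertwining_derivative:
  assumes "open U" "q \<in> U" "(Y has_derivative D) (at q)" "\<And>r. r \<in> U \<Longrightarrow> Y r \<odot> x = H \<odot> Y r"
  shows "D h \<odot> x = H \<odot> D h"
proof -
  have "((\<lambda>r. Y r \<odot> x - H \<odot> Y r) has_derivative (\<lambda>h. D h \<odot> x - H \<odot> D h)) (at q)"
    by (intro has_derivative_diff bounded_linear.has_derivative[OF pmult.bounded_linear_left]
        bounded_linear.has_derivative[OF pmult.bounded_linear_right] assms)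
  moreover have "((\<lambda>r. Y r \<odot> x - H \<odot> Y r) has_derivative (\<lambda>h. 0)) (at q)"
    by (rule has_derivative_transform_within_open[OF has_derivative_const assms(1,2)]) (simp add: assms(4))
  ultimately have "(\<lambda>h. D h \<odot> x - H \<odot> D h) = (\<lambda>h. 0)"
    by (rule has_derivative_unique)
  then have "D h \<odot> x - H \<odot> D h = 0"
    by meson
  then show ?thesis by simp
qed

text \<open>A coordinate patch of a totally geodesic almost complex surface with negative definite metric.\<close>

locale negative_patch =
  fixes U :: "(real^2) set" and X :: "real^2 \<Rightarrow> mat2 \<times> mat2"
  assumes open_U: "open U"
    and smooth_X: "smooth_on U X"
    and X_in: "\<And>q. q \<in> U \<Longrightarrow> X q \<in> SL2xSL2"
    and J_inv: "\<And>q. q \<in> U \<Longrightarrow> J_SL (X q) ` range (dderiv X U q) \<subseteq> range (dderiv X U q)"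
    and neg: "\<And>q a. q \<in> U \<Longrightarrow> a \<noteq> 0 \<Longrightarrow> induced_metric g_SL U X q a a < 0"
    and geodesic: "\<And>q a b. q \<in> U \<Longrightarrow>
      second_fundamental_form SL2xSL2 tangent_SL g_SL U X q a b = 0"
begin

text \<open>Pull-back of the Maurer-Cartan form: the left translate of the differential to the identity.\<close>

definition omega :: "real^2 \<Rightarrow> real^2 \<Rightarrow> mat2 \<times> mat2" where
  "omega q v = padj (X q) \<odot> dderiv X U q v"

lemmas dX = smooth_on_open_derivatives(1)[OF open_U smooth_X]
lemmas ddX = smooth_on_open_derivatives(2)[OF open_U smooth_X]

lemma dX_omega: "q \<in> U \<Longrightarrow> dderiv X U q v = X q \<odot> omega q v"
  by (simp add: omega_def pmult_padj_cancel X_in)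

lemma linear_omega: "q \<in> U \<Longrightarrow> linear (omega q)"
  using has_derivative_linear[OF dX]
  by (auto simp: omega_def linear_iff pmult.add_right pmult.scaleR_right)

lemma omega_sl2:
  assumes q: "q \<in> U"
  shows "omega q v \<in> sl2_pairs"
  unfolding omega_def by (rule SL_valued_derivative[OF open_U q dX[OF q] X_in])

text \<open>The derivative of \<open>omega \<cdot> b\<close> in direction \<open>a\<close>, as computed by the
  product rule.\<close>

definition d_omega :: "real^2 \<Rightarrow> real^2 \<Rightarrow> real^2 \<Rightarrow> mat2 \<times> mat2" where
  "d_omega q b a = padj (X q) \<odot> dderiv (\<lambda>r. dderiv X U r b) U q a - omega q a \<odot> omega q b"

lemma omega_has_derivative:
  assumes q: "q \<in> U"
  shows "((\<lambda>r. omega r b) has_derivative d_omega q b) (at q)"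
proof -
  have "((\<lambda>r. omega r b) has_derivative (\<lambda>h. padj (X q) \<odot> dderiv (\<lambda>r. dderiv X U r b) U q h
      + padj (dderiv X U q h) \<odot> dderiv X U q b)) (at q)"
    unfolding omega_def
    by (intro pmult.FDERIV bounded_linear.has_derivative[OF bounded_linear_padj] dX ddX q)
  moreover have "padj (dderiv X U q h) \<odot> dderiv X U q b = - (omega q h \<odot> omega q b)" for h
    using padj_sl2[OF omega_sl2[OF q]]
    by (simp add: dX_omega[OF q] padj_pmult pmult_assoc pmult_padj_cancel[OF X_in[OF q]] pmult.minus_left)
  ultimately show ?thesis
    by (simp add: d_omega_def[abs_def])
qed

lemma d_omega_sl2:
  assumes q: "q \<in> U"
  shows "d_omega q b a \<in> sl2_pairs"
proof -
  have "((\<lambda>r. padj (omega r b) + omega r b) has_derivative (\<lambda>a. padj (d_omega q b a) + d_omega q b a)) (at q)"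
    by (intro has_derivative_add bounded_linear.has_derivative[OF bounded_linear_padj] omega_has_derivative q)
  moreover have "((\<lambda>r. padj (omega r b) + omega r b) has_derivative (\<lambda>a. 0)) (at q)"
    by (rule has_derivative_transform_within_open[OF has_derivative_const open_U q])
       (use omega_sl2 in \<open>simp add: sl2_iff\<close>)
  ultimately have "(\<lambda>a. padj (d_omega q b a) + d_omega q b a) = (\<lambda>a. 0)"
    by (rule has_derivative_unique)
  then have "padj (d_omega q b a) + d_omega q b a = 0"
    by meson
  then show ?thesis
    by (simp add: sl2_iff)
qed

lemma nabla_along_omega:
  assumes q: "q \<in> U"
  shows "nabla_along U (levi_civita SL2xSL2 tangent_SL g_SL) X (\<lambda>r. dderiv X U r b) q a =
    X q \<odot> (d_omega q b a + conn (omega q a) (omega q b))"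
proof -
  have T: "dderiv X U q v \<in> tangent_SL (X q)" for v
    using omega_sl2[OF q] by (simp add: tangent_SL_iff X_in q flip: omega_def)
  show ?thesis
    unfolding nabla_along_def levi_civita_SL[OF X_in[OF q] T T]
    by (simp add: lc_tensor_def d_omega_def pmult.add_right pmult.diff_right pmult_padj_cancel[OF X_in[OF q]]
        flip: omega_def)
qed

lemma induced_metric_omega:
  "q \<in> U \<Longrightarrow> induced_metric g_SL U X q a b = g0 (omega q a) (omega q b)"
  by (simp add: induced_metric_def g_SL_eq X_in omega_def)

lemma g0_omega_zero:
  assumes q: "q \<in> U" and "\<And>b. g0 (omega q a) (omega q b) = 0"
  shows "a = 0"
  using neg[OF q, of a] assms(2)[of a] by (auto simp: induced_metric_omega[OF q])

lemma omega_basis: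
  assumes q: "q \<in> U"
  shows "omega q h = h $ 1 *\<^sub>R omega q (axis 1 1) + h $ 2 *\<^sub>R omega q (axis 2 1)"
proof -
  have "h = h $ 1 *\<^sub>R axis 1 1 + h $ 2 *\<^sub>R axis 2 1"
    by (simp add: vec_eq_iff forall_2 axis_def)
  from arg_cong[OF this, of "omega q"] show ?thesis
    using linear_omega[OF q] by (simp only: linear_add linear_cmul)
qed

text \<open>Because the metric on the tangent plane is definite, the Gram map \<open>L\<close> is injective,
  hence onto.\<close>

lemma orthogonal_projection:
  assumes q: "q \<in> U"
  obtains c where "\<And>b. g0 (y - omega q c) (omega q b) = 0"
proof -
  let ?e1 = "axis 1 1 :: real^2" and ?e2 = "axis 2 1 :: real^2"
  note lin = linear_omega[OF q] and omega_h = omega_basis[OF q]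
  define L where "L c = (vector [g0 (omega q c) (omega q ?e1), g0 (omega q c) (omega q ?e2)] :: real^2)" for c
  have linL: "linear L"
    using lin by (auto simp: linear_iff L_def vec_eq_iff forall_2 g0.add_left g0.scaleR_left)
  have "inj L"
  proof (rule linear_injective_0[OF linL, THEN iffD2, rule_format])
    fix c assume "L c = 0"
    then have "g0 (omega q c) (omega q ?e1) = 0" "g0 (omega q c) (omega q ?e2) = 0"
      by (simp_all add: L_def vec_eq_iff forall_2)
    then have "g0 (omega q c) (omega q b) = 0" for b
      by (subst omega_h[of b]) (simp add: g0.add_right g0.scaleR_right)
    then show "c = 0"
      by (rule g0_omega_zero[OF q])
  qed
  then obtain c where c: "L c = vector [g0 y (omega q ?e1), g0 y (omega q ?e2)]"
    using linear_injective_imp_surjective[OF linL] by (metis surjD)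
  then have "g0 (y - omega q c) (omega q ?e1) = 0" "g0 (y - omega q c) (omega q ?e2) = 0"
    by (simp_all add: L_def vec_eq_iff forall_2 g0.diff_left)
  then have "g0 (y - omega q c) (omega q b) = 0" for b
    by (subst omega_h[of b]) (simp add: g0.add_right g0.scaleR_right)
  then show ?thesis
    using that by blast
qed

text \<open>The description of the second fundamental form by a definite description is meaningful because the
  tangential and normal components exist and are unique; its vanishing says that the covariant
  derivative of \<open>dX(b)\<close> is tangent to the surface.\<close>

lemma geodesic_omega:
  assumes q: "q \<in> U"
  obtains c where "d_omega q b a + conn (omega q a) (omega q b) = omega q c"
proof -
  define y where "y = d_omega q b a + conn (omega q a) (omega q b)"
  have y: "y \<in> sl2_pairs"
    unfolding y_def by (intro subspace_add[OF subspace_sl2] d_omega_sl2 conn_sl2 q)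
  obtain c where c: "\<And>b. g0 (y - omega q c) (omega q b) = 0"
    using orthogonal_projection[OF q] by metis
  let ?P = "\<lambda>n. n \<in> tangent_SL (X q) \<and> (\<forall>c. g_SL (X q) n (dderiv X U q c) = 0) \<and>
     (\<exists>c. nabla_along U (levi_civita SL2xSL2 tangent_SL g_SL) X (\<lambda>r. dderiv X U r b) q a
        = dderiv X U q c + n)"
  have "?P (X q \<odot> (y - omega q c))"
  proof (intro conjI exI allI)
    show "X q \<odot> (y - omega q c) \<in> tangent_SL (X q)"
      unfolding tangent_SL_eq by (intro imageI subspace_diff[OF subspace_sl2] y omega_sl2 q)
    show "g_SL (X q) (X q \<odot> (y - omega q c)) (dderiv X U q b) = 0" for b
      by (simp add: g_SL_eq[OF X_in[OF q]] pmult_padj_cancel[OF X_in[OF q]] c flip: omega_def)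
    show "nabla_along U (levi_civita SL2xSL2 tangent_SL g_SL) X (\<lambda>r. dderiv X U r b) q a
        = dderiv X U q c + X q \<odot> (y - omega q c)"
      by (simp add: nabla_along_omega[OF q] dX_omega[OF q] y_def flip: pmult.add_right)
  qed
  moreover have "n = X q \<odot> (y - omega q c)" if n: "?P n" for n
  proof -
    obtain x where x: "n = X q \<odot> x"
      using n unfolding tangent_SL_eq by blast
    have ort: "g0 x (omega q b) = 0" for b
      using n by (simp add: x g_SL_eq[OF X_in[OF q]] pmult_padj_cancel[OF X_in[OF q]] flip: omega_def)
    obtain c' where "X q \<odot> y = X q \<odot> (omega q c' + x)"
      using n by (auto simp: nabla_along_omega[OF q] dX_omega[OF q] y_def x pmult.add_right)
    then have c': "y = omega q c' + x"
      using pmult_padj_cancel(2)[OF X_in[OF q]] by metis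
    have "omega q (c' - c) = (y - omega q c) - x"
      by (simp add: c' linear_diff[OF linear_omega[OF q]])
    then have "g0 (omega q (c' - c)) (omega q b) = 0" for b
      by (simp only: g0.diff_left[of "y - omega q c" x] c ort diff_0_right)
    then have "c' - c = 0"
      by (rule g0_omega_zero[OF q])
    then show ?thesis
      by (simp add: x c')
  qed
  ultimately have "(THE n. ?P n) = X q \<odot> (y - omega q c)"
    by (rule the_equality)
  then have "X q \<odot> (y - omega q c) = 0"
    using geodesic[OF q, of a b] unfolding second_fundamental_form_def by simp
  then have "y - omega q c = 0"
    using pmult_padj_cancel(2)[OF X_in[OF q], of "y - omega q c"] by (simp add: pmult.zero_right)
  then show ?thesis
    using that[of c] by (simp add: y_def)
qed

end

section \<open>The differential system for the tangent line\<close>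

context negative_patch
begin

text \<open>The tangent line is spanned by the complex matrix with rows \<open>(line_u, line_v)\<close> and
  \<open>(1, - line_u)\<close>.\<close>

definition line_u :: "real^2 \<Rightarrow> complex" where
  "line_u q = cxentry 1 1 (omega q (axis 1 1)) / cxentry 2 1 (omega q (axis 1 1))"

definition line_v :: "real^2 \<Rightarrow> complex" where
  "line_v q = cxentry 1 2 (omega q (axis 1 1)) / cxentry 2 1 (omega q (axis 1 1))"

text \<open>The 1-form in the system satisfied by \<open>line_u\<close> and \<open>line_v\<close>. The constant
  is \<open>root3\<^sup>2 / 3\<close>.\<close>

definition theta :: "real^2 \<Rightarrow> real^2 \<Rightarrow> complex" where
  "theta q h = - (1 + root3) / 3 * cnj (cxentry 2 1 (omega q h))"

definition slope_u :: "real^2 \<Rightarrow> complex" where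
  "slope_u q = cnj (line_v q) - line_v q - 2 * (line_u q - cnj (line_u q)) * line_u q"

definition slope_v :: "real^2 \<Rightarrow> complex" where
  "slope_v q = 2 * (cnj (line_u q) * line_v q - line_u q * cnj (line_v q)) - 2 * (line_u q - cnj (line_u q)) * line_v q"

text \<open>The translated tangent plane is invariant under multiplication by \<open>\<i>\<close>, so it is the
  complex line through the image of the first coordinate vector. The second coordinate vector is a
  multiple by a number that is not real, since otherwise the differential would not be injective.\<close>

lemma complex_line:
  assumes q: "q \<in> U"
  obtains \<mu> where "Im \<mu> \<noteq> 0"
    "\<And>i j h. cxentry i j (omega q h) = (of_real (h $ 1) + of_real (h $ 2) * \<mu>) * cxentry i j (omega q (axis 1 1))"
proof -
  let ?e1 = "axis 1 1 :: real^2" and ?e2 = "axis 2 1 :: real^2"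
  obtain c where c: "J_SL (X q) (dderiv X U q ?e1) = dderiv X U q c"
    using J_inv[OF q] by blast
  have J: "\<i> * cxentry i j (omega q ?e1) = of_real (c $ 1) * cxentry i j (omega q ?e1) + of_real (c $ 2) * cxentry i j (omega q ?e2)" for i j
  proof -
    have "\<i> * cxentry i j (omega q ?e1) = cxentry i j (padj (X q) \<odot> J_SL (X q) (dderiv X U q ?e1))"
      unfolding dX_omega[OF q, of ?e1] by (rule J_SL_cxentry[OF X_in[OF q], symmetric])
    also have "\<dots> = cxentry i j (omega q c)"
      by (simp add: c omega_def)
    finally show ?thesis
      by (simp add: omega_basis[OF q, of c] cxentry_linear)
  qed
  \<comment> \<open>Otherwise multiplication by \<open>\<i>\<close> would have a real eigenvalue.\<close>
  have "c $ 2 \<noteq> 0"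
  proof
    assume "c $ 2 = 0"
    then have "(\<i> - of_real (c $ 1)) * cxentry i j (omega q ?e1) = 0" for i j
      using J[of i j] by (simp add: algebra_simps)
    moreover have "\<i> - of_real (c $ 1) \<noteq> 0"
      by (simp add: complex_eq_iff)
    ultimately have "cxentry i j (omega q ?e1) = 0" for i j
      by simp
    then have "omega q ?e1 = 0"
      by (simp add: cxentry_eq_0 prod_eq_iff mat2_eq_iff)
    then have "?e1 = 0"
      by (intro g0_omega_zero[OF q]) (simp add: g0.zero_left)
    then show False
      by (simp add: axis_eq_0_iff)
  qed
  define \<mu> where "\<mu> = (\<i> - of_real (c $ 1)) / of_real (c $ 2)"
  have e2: "cxentry i j (omega q ?e2) = \<mu> * cxentry i j (omega q ?e1)" for i j
    using J[of i j] \<open>c $ 2 \<noteq> 0\<close> by (simp add: \<mu>_def field_simps)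
  have "cxentry i j (omega q h) = (of_real (h $ 1) + of_real (h $ 2) * \<mu>) * cxentry i j (omega q (axis 1 1))" for i j h
    by (subst omega_basis[OF q]) (simp add: cxentry_linear e2 algebra_simps)
  moreover have "Im \<mu> \<noteq> 0"
    using \<open>c $ 2 \<noteq> 0\<close> by (simp add: \<mu>_def Im_divide_of_real)
  ultimately show ?thesis
    using that by blast
qed

text \<open>If the lower-left entry vanished, \<open>g0_cxentry\<close> would leave a nonnegative square.\<close>

lemma omega_21_nonzero:
  assumes q: "q \<in> U"
  shows "cxentry 2 1 (omega q (axis 1 1)) \<noteq> 0"
proof
  assume "cxentry 2 1 (omega q (axis 1 1)) = 0"
  then have "g0 (omega q (axis 1 1)) (omega q (axis 1 1)) \<ge> 0"
    by (simp add: g0_cxentry[OF omega_sl2[OF q]])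
  then show False
    using neg[OF q, of "axis 1 1"] by (simp add: induced_metric_omega[OF q] axis_eq_0_iff)
qed

lemma omega_line:
  assumes q: "q \<in> U"
  shows "cxentry 1 1 (omega q h) = line_u q * cxentry 2 1 (omega q h)" "cxentry 1 2 (omega q h) = line_v q * cxentry 2 1 (omega q h)"
proof -
  obtain \<mu> where "\<And>i j h. cxentry i j (omega q h) =
      (of_real (h $ 1) + of_real (h $ 2) * \<mu>) * cxentry i j (omega q (axis 1 1))"
    using complex_line[OF q] by metis
  note \<mu> = this[of _ _ h]
  show "cxentry 1 1 (omega q h) = line_u q * cxentry 2 1 (omega q h)" "cxentry 1 2 (omega q h) = line_v q * cxentry 2 1 (omega q h)"
    unfolding \<mu>[of 1 1] \<mu>[of 1 2] \<mu>[of 2 1] using omega_21_nonzero[OF q] by (simp_all add: line_u_def line_v_def)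
qed

lemma uv_negative:
  assumes q: "q \<in> U"
  shows "(cmod (line_u q))\<^sup>2 + Re (line_v q) < 0"
proof -
  let ?w = "omega q (axis 1 1)"
  define a where "a = cxentry 2 1 ?w"
  have "g0 ?w ?w < 0"
    using neg[OF q, of "axis 1 1"] by (simp add: induced_metric_omega[OF q] axis_eq_0_iff)
  then have "(cmod (line_u q * a))\<^sup>2 + Re (line_v q * a * cnj a) < 0"
    by (simp add: g0_cxentry[OF omega_sl2[OF q]] omega_line[OF q] flip: a_def)
  also have "(cmod (line_u q * a))\<^sup>2 + Re (line_v q * a * cnj a) = (cmod a)\<^sup>2 * ((cmod (line_u q))\<^sup>2 + Re (line_v q))"
    unfolding cmod_power2 by (simp add: power2_eq_square algebra_simps)
  finally show ?thesis
    by (simp add: mult_less_0_iff)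
qed

text \<open>The derivative of a ratio of entries does not change if an element of the tangent line is added to
  the derivative of \<open>omega\<close>. By \<open>geodesic_omega\<close> the derivative of
  \<open>omega\<close> is \<open>- conn\<close> up to such an element, and \<open>conn\<close> is
  known on the line.\<close>

lemma uv_derivative:
  assumes q: "q \<in> U"
  shows "(line_u has_derivative (\<lambda>h. theta q h * slope_u q)) (at q)"
    and "(line_v has_derivative (\<lambda>h. theta q h * slope_v q)) (at q)"
proof -
  let ?e = "axis 1 1 :: real^2"
  have nz: "cxentry 2 1 (omega q ?e) \<noteq> 0"
    by (rule omega_21_nonzero[OF q])
  define a where "a = cxentry 2 1 (omega q ?e)"
  have d: "((\<lambda>r. cxentry i j (omega r ?e)) has_derivative (\<lambda>h. cxentry i j (d_omega q ?e h))) (at q)" for i j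
    by (rule bounded_linear.has_derivative[OF bounded_linear_cxentry omega_has_derivative[OF q]])
  have ratio: "((\<lambda>r. cxentry i j (omega r ?e) / cxentry 2 1 (omega r ?e)) has_derivative
      (\<lambda>h. (cxentry i j (d_omega q ?e h) - w * cxentry 2 1 (d_omega q ?e h)) / a)) (at q)"
    if w: "cxentry i j (omega q ?e) = w * a" for i j w
  proof -
    have "((\<lambda>r. cxentry i j (omega r ?e) / cxentry 2 1 (omega r ?e)) has_derivative
      (\<lambda>h. - cxentry i j (omega q ?e) * (inverse (cxentry 2 1 (omega q ?e)) * cxentry 2 1 (d_omega q ?e h) * inverse (cxentry 2 1 (omega q ?e)))
         + cxentry i j (d_omega q ?e h) / cxentry 2 1 (omega q ?e))) (at q)"
      by (rule has_derivative_divide[OF d d nz])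
    moreover have "- cxentry i j (omega q ?e) * (inverse (cxentry 2 1 (omega q ?e)) * cxentry 2 1 (d_omega q ?e h) * inverse (cxentry 2 1 (omega q ?e)))
         + cxentry i j (d_omega q ?e h) / cxentry 2 1 (omega q ?e) = (cxentry i j (d_omega q ?e h) - w * cxentry 2 1 (d_omega q ?e h)) / a" for h
      unfolding w using nz by (simp add: a_def field_simps)
    ultimately show ?thesis
      by simp
  qed
  note cl = conn_complex_line[OF omega_sl2[OF q] omega_line[OF q] refl omega_sl2[OF q] omega_line[OF q] refl]
  have "(cxentry 1 1 (d_omega q ?e h) - line_u q * cxentry 2 1 (d_omega q ?e h)) / a = theta q h * slope_u q
     \<and> (cxentry 1 2 (d_omega q ?e h) - line_v q * cxentry 2 1 (d_omega q ?e h)) / a = theta q h * slope_v q" for h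
  proof -
    obtain c where "d_omega q ?e h + conn (omega q h) (omega q ?e) = omega q c"
      using geodesic_omega[OF q] by metis
    then have D: "cxentry i j (d_omega q ?e h) = cxentry i j (omega q c) - cxentry i j (conn (omega q h) (omega q ?e))" for i j
      by (metis add_diff_cancel_right' cxentry_linear(1))
    have t3: "3 * theta q h = - (1 + root3) * cnj (cxentry 2 1 (omega q h))"
      by (simp add: theta_def)
    have "3 * (cxentry 1 1 (d_omega q ?e h) - line_u q * cxentry 2 1 (d_omega q ?e h)) = 3 * (theta q h * slope_u q * a)"
      "3 * (cxentry 1 2 (d_omega q ?e h) - line_v q * cxentry 2 1 (d_omega q ?e h)) = 3 * (theta q h * slope_v q * a)"
      using cl[of h ?e, folded a_def] t3 unfolding D omega_line[OF q, of c] slope_u_def slope_v_def by algebra+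
    then show ?thesis
      unfolding a_def nonzero_divide_eq_eq[OF nz] mult_cancel_left by simp
  qed
  then have E: "(cxentry 1 1 (d_omega q ?e h) - line_u q * cxentry 2 1 (d_omega q ?e h)) / a = theta q h * slope_u q"
    "(cxentry 1 2 (d_omega q ?e h) - line_v q * cxentry 2 1 (d_omega q ?e h)) / a = theta q h * slope_v q" for h
    by blast+
  have "line_u = (\<lambda>r. cxentry 1 1 (omega r ?e) / cxentry 2 1 (omega r ?e))" "line_v = (\<lambda>r. cxentry 1 2 (omega r ?e) / cxentry 2 1 (omega r ?e))"
    by (rule ext, simp add: line_u_def line_v_def)+
  then show "(line_u has_derivative (\<lambda>h. theta q h * slope_u q)) (at q)"
    and "(line_v has_derivative (\<lambda>h. theta q h * slope_v q)) (at q)"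
    using ratio[OF omega_line(1)[OF q, of ?e, folded a_def], unfolded E] ratio[OF omega_line(2)[OF q, of ?e, folded a_def], unfolded E]
    by simp_all
qed

text \<open>Equate the mixed second derivatives of \<open>line_u\<close> and of \<open>line_v\<close> and
  eliminate the derivative of \<open>theta\<close> from the two equations.\<close>

lemma uv_real:
  assumes q: "q \<in> U"
  shows "Im (line_u q) = 0" "Im (line_v q) = 0"
proof -
  let ?e1 = "axis 1 1 :: real^2" and ?e2 = "axis 2 1 :: real^2"
  define T where "T e h = - (1 + root3) / 3 * cnj (cxentry 2 1 (d_omega q e h))" for e h
  have th': "((\<lambda>r. theta r e) has_derivative T e) (at q)" for e
    unfolding theta_def T_def[abs_def]
    by (intro has_derivative_mult_right bounded_linear.has_derivative[OF bounded_linear_cnj]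
        bounded_linear.has_derivative[OF bounded_linear_cxentry] omega_has_derivative q)
  note du = uv_derivative(1)[OF q] and dv = uv_derivative(2)[OF q]
  note cnj' = bounded_linear.has_derivative[OF bounded_linear_cnj]
  define F where "F h = cnj (theta q h * slope_v q) - theta q h * slope_v q
      - 2 * ((theta q h * slope_u q - cnj (theta q h * slope_u q)) * line_u q + (line_u q - cnj (line_u q)) * (theta q h * slope_u q))" for h
  define K where "K h = 2 * (cnj (theta q h * slope_u q) * line_v q + cnj (line_u q) * (theta q h * slope_v q)
        - (theta q h * slope_u q * cnj (line_v q) + line_u q * cnj (theta q h * slope_v q)))
      - 2 * ((theta q h * slope_u q - cnj (theta q h * slope_u q)) * line_v q + (line_u q - cnj (line_u q)) * (theta q h * slope_v q))" for h
  have "((\<lambda>q. cnj (line_v q) - line_v q - 2 * (line_u q - cnj (line_u q)) * line_u q) has_derivative F) (at q)"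
    unfolding F_def[abs_def]
    by (rule derivative_eq_intros du dv cnj' refl)+ (simp add: algebra_simps)
  then have f': "(slope_u has_derivative F) (at q)"
    unfolding slope_u_def[abs_def] .
  have "((\<lambda>q. 2 * (cnj (line_u q) * line_v q - line_u q * cnj (line_v q)) - 2 * (line_u q - cnj (line_u q)) * line_v q) has_derivative K) (at q)"
    unfolding K_def[abs_def]
    by (rule derivative_eq_intros du dv cnj' refl)+ (simp add: algebra_simps)
  then have k': "(slope_v has_derivative K) (at q)"
    unfolding slope_v_def[abs_def] .
  have symF: "theta q ?e1 * F ?e2 + T ?e1 ?e2 * slope_u q = theta q ?e2 * F ?e1 + T ?e2 ?e1 * slope_u q"
    by (rule symmetric_second_derivative[OF open_U q uv_derivative(1)
          has_derivative_mult[OF th' f'] has_derivative_mult[OF th' f']])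
  have symK: "theta q ?e1 * K ?e2 + T ?e1 ?e2 * slope_v q = theta q ?e2 * K ?e1 + T ?e2 ?e1 * slope_v q"
    by (rule symmetric_second_derivative[OF open_U q uv_derivative(2)
          has_derivative_mult[OF th' k'] has_derivative_mult[OF th' k']])
  have move: "y - x = a - b" if "a + x = b + y" for a b x y :: complex
    using that by algebra
  define t where "t = T ?e2 ?e1 - T ?e1 ?e2"
  define \<Delta> where "\<Delta> = theta q ?e1 * cnj (theta q ?e2) - theta q ?e2 * cnj (theta q ?e1)"
  \<comment> \<open>The holomorphic parts of the derivatives of the slopes contribute terms symmetric in the two
    directions; only the derivatives with respect to the conjugates of \<open>u\<close> and \<open>v\<close> remain, with
    the common factor \<open>\<Delta>\<close>.\<close>
  have tf: "t * slope_u q = \<Delta> * (2 * line_u q * cnj (slope_u q) + cnj (slope_v q))" (is "_ = ?rhs")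
  proof -
    have "t * slope_u q = theta q ?e1 * F ?e2 - theta q ?e2 * F ?e1"
      unfolding t_def left_diff_distrib by (rule move[OF symF])
    also have "\<dots> = ?rhs"
      by (simp add: F_def \<Delta>_def algebra_simps)
    finally show ?thesis .
  qed
  have tk: "t * slope_v q = \<Delta> * (4 * line_v q * cnj (slope_u q) - 2 * line_u q * cnj (slope_v q))" (is "_ = ?rhs")
  proof -
    have "t * slope_v q = theta q ?e1 * K ?e2 - theta q ?e2 * K ?e1"
      unfolding t_def left_diff_distrib by (rule move[OF symK])
    also have "\<dots> = ?rhs"
      by (simp add: K_def \<Delta>_def algebra_simps)
    finally show ?thesis .
  qed
  have "\<Delta> \<noteq> 0"
  proof -
    obtain \<mu> where \<mu>: "Im \<mu> \<noteq> 0" "\<And>i j h. cxentry i j (omega q h) =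
        (of_real (h $ 1) + of_real (h $ 2) * \<mu>) * cxentry i j (omega q ?e1)"
      using complex_line[OF q] by metis
    have "theta q ?e2 = cnj \<mu> * theta q ?e1"
      unfolding theta_def \<mu>(2)[of 2 1 ?e2] by (simp add: axis_def)
    then have "\<Delta> = (theta q ?e1 * cnj (theta q ?e1)) * (\<mu> - cnj \<mu>)"
      by (simp add: \<Delta>_def algebra_simps)
    moreover have "theta q ?e1 \<noteq> 0"
    proof -
      have "- (1 + root3) / 3 \<noteq> 0"
        by (simp add: root3_def complex_eq_iff)
      then show ?thesis
        using omega_21_nonzero[OF q] unfolding theta_def by (metis complex_cnj_zero_iff mult_eq_0_iff)
    qed
    moreover have "\<mu> \<noteq> cnj \<mu>"
      using \<mu>(1) by (simp add: complex_eq_iff)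
    ultimately show ?thesis
      by simp
  qed
  have "\<Delta> * (cnj (slope_v q) * slope_v q + 2 * line_u q * cnj (slope_u q) * slope_v q + 2 * line_u q * cnj (slope_v q) * slope_u q - 4 * line_v q * cnj (slope_u q) * slope_u q)
      = (\<Delta> * (2 * line_u q * cnj (slope_u q) + cnj (slope_v q))) * slope_v q - (\<Delta> * (4 * line_v q * cnj (slope_u q) - 2 * line_u q * cnj (slope_v q))) * slope_u q"
    by (simp add: algebra_simps)
  also have "\<dots> = 0"
    unfolding tf[symmetric] tk[symmetric] by simp
  finally have "\<Delta> * (cnj (slope_v q) * slope_v q + 2 * line_u q * cnj (slope_u q) * slope_v q + 2 * line_u q * cnj (slope_v q) * slope_u q
      - 4 * line_v q * cnj (slope_u q) * slope_u q) = 0" .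
  moreover have I: "cnj (slope_v q) * slope_v q + 2 * line_u q * cnj (slope_u q) * slope_v q + 2 * line_u q * cnj (slope_v q) * slope_u q
      - 4 * line_v q * cnj (slope_u q) * slope_u q = 4 * (line_u q ^ 2 + line_v q) * ((cnj (line_v q) - line_v q)\<^sup>2
      + 4 * (cnj (line_u q) * line_v q - line_u q * cnj (line_v q)) * (line_u q - cnj (line_u q)))"
    unfolding slope_u_def slope_v_def by (rule integrability_factorization)
  ultimately have "4 * (line_u q ^ 2 + line_v q) * ((cnj (line_v q) - line_v q)\<^sup>2
      + 4 * (cnj (line_u q) * line_v q - line_u q * cnj (line_v q)) * (line_u q - cnj (line_u q))) = 0"
    using \<open>\<Delta> \<noteq> 0\<close> unfolding mult_eq_0_iff[of \<Delta>] I by blast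
  then have "(line_u q ^ 2 + line_v q) * ((cnj (line_v q) - line_v q)\<^sup>2
      + 4 * (cnj (line_u q) * line_v q - line_u q * cnj (line_v q)) * (line_u q - cnj (line_u q))) = 0"
    by (simp only: mult.assoc mult_eq_0_iff) simp
  then show "Im (line_u q) = 0" "Im (line_v q) = 0"
    using negative_line_real[OF uv_negative[OF q]] by auto
qed

end

section \<open>Local torus structure\<close>

text \<open>Real generators of a tangent line, normalized by the lower-left entry so that each line has only
  one.\<close>

definition line_gen :: "mat2 \<Rightarrow> bool" where
  "line_gen \<xi> \<longleftrightarrow> trace \<xi> = 0 \<and> \<xi> $ 2 $ 1 = 1 \<and> det \<xi> > 0"

lemma cxentry_real_multiple:
  assumes "cxentry i j w = z * cxentry i' j' w" "Im z = 0"
  shows "fst w $ i $ j = Re z * fst w $ i' $ j'" "snd w $ i $ j = Re z * snd w $ i' $ j'"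
  using assms by (auto simp: cxentry_def root3_def complex_eq_iff algebra_simps)

context negative_patch
begin

text \<open>Real \<open>line_u\<close> and \<open>line_v\<close> make both slopes vanish, so they are constant
  on a ball. There \<open>omega\<close> takes values in pairs of multiples of one matrix
  \<open>\<xi>\<close>; it commutes with \<open>(\<xi>, \<xi>)\<close>, and the conjugate of
  \<open>(\<xi>, \<xi>)\<close> by \<open>X\<close> has derivative zero.\<close>

lemma local_torus:
  assumes q: "q \<in> U"
  obtains V \<xi> H where "open V" "q \<in> V" "V \<subseteq> U" "line_gen \<xi>" "\<And>r. r \<in> V \<Longrightarrow> X r \<odot> (\<xi>, \<xi>) = H \<odot> X r"
proof -
  obtain e where e: "e > 0" "ball q e \<subseteq> U"
    using open_U q openE by blast
  define a b where "a = Re (line_u q)" and "b = Re (line_v q)"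
  have fk: "slope_u r = 0" "slope_v r = 0" if "r \<in> U" for r
    using uv_real[OF that] by (simp_all add: slope_u_def slope_v_def complex_eq_iff)
  have u0: "(line_u has_derivative (\<lambda>h. 0)) (at r)" "(line_v has_derivative (\<lambda>h. 0)) (at r)" if "r \<in> U" for r
    using uv_derivative[OF that] fk[OF that] by simp_all
  have const: "g r = g q" if "\<And>r. r \<in> ball q e \<Longrightarrow> (g has_derivative (\<lambda>h. 0)) (at r)" "r \<in> ball q e"
    for g :: "real^2 \<Rightarrow> 'b::real_normed_vector" and r
    by (rule has_derivative_zero_unique[OF convex_ball has_derivative_at_withinI[OF that(1)]])
       (use that(2) \<open>e > 0\<close> in auto)
  define \<xi> :: mat2 where "\<xi> = vector [vector [a, b], vector [1, - a]]"
  have "a\<^sup>2 + b < 0"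
    using uv_negative[OF q] uv_real[OF q] unfolding cmod_power2 by (simp add: a_def b_def)
  then have gen: "line_gen \<xi>"
    by (simp add: line_gen_def \<xi>_def trace_nth det_2 power2_eq_square)
  have comm0: "omega r h \<odot> (\<xi>, \<xi>) = (\<xi>, \<xi>) \<odot> omega r h" if r: "r \<in> ball q e" for r h
  proof -
    have rU: "r \<in> U" using r e by auto
    have uv: "Re (line_u r) = a" "Re (line_v r) = b"
      using const[OF u0(1)[OF subsetD[OF e(2)]] r] const[OF u0(2)[OF subsetD[OF e(2)]] r]
      by (simp_all add: a_def b_def)
    note 1 = cxentry_real_multiple[OF omega_line(1)[OF rU, of h] uv_real(1)[OF rU], unfolded uv]
    note 2 = cxentry_real_multiple[OF omega_line(2)[OF rU, of h] uv_real(2)[OF rU], unfolded uv]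
    have "snd (omega r h) $ 2 $ 2 = - snd (omega r h) $ 1 $ 1" "fst (omega r h) $ 2 $ 2 = - fst (omega r h) $ 1 $ 1"
      using omega_sl2[OF rU, of h] by (auto simp: sl2_pairs_def trace_nth)
    then show ?thesis
      by (simp add: pmult_def prod_eq_iff mat2_simps 1 2 \<xi>_def algebra_simps)
  qed
  define G where "G r = X r \<odot> (\<xi>, \<xi>) \<odot> padj (X r)" for r
  have "(G has_derivative (\<lambda>h. 0)) (at r)" if r: "r \<in> ball q e" for r
  proof -
    have rU: "r \<in> U" using r e by auto
    have "(G has_derivative (\<lambda>h. X r \<odot> (\<xi>, \<xi>) \<odot> padj (dderiv X U r h) +
        dderiv X U r h \<odot> (\<xi>, \<xi>) \<odot> padj (X r))) (at r)"
      unfolding G_def[abs_def]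
      by (intro pmult.FDERIV bounded_linear.has_derivative[OF bounded_linear_padj]
          bounded_linear.has_derivative[OF pmult.bounded_linear_left] dX rU)
    moreover have "X r \<odot> (\<xi>, \<xi>) \<odot> padj (dderiv X U r h) + dderiv X U r h \<odot> (\<xi>, \<xi>) \<odot> padj (X r) = 0" for h
    proof -
      have "X r \<odot> (omega r h \<odot> (\<xi>, \<xi>)) \<odot> padj (X r) = X r \<odot> ((\<xi>, \<xi>) \<odot> omega r h) \<odot> padj (X r)"
        by (simp only: comm0[OF r, of h])
      then show ?thesis
        by (simp add: dX_omega[OF rU] padj_pmult padj_sl2[OF omega_sl2[OF rU]] pmult.minus_left
            pmult.minus_right pmult_assoc)
    qed
    ultimately show ?thesis by simp
  qed
  then have G: "G r = G q" if "r \<in> ball q e" for r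
    using const that by blast
  have "X r \<odot> (\<xi>, \<xi>) = G q \<odot> X r" if r: "r \<in> ball q e" for r
  proof -
    have "padj (X r) \<odot> X r = (mat 1, mat 1)"
      using X_in[OF subsetD[OF e(2) r]] by (auto simp: SL2xSL2_def padj_def pmult_def mult_adj2)
    then have "G r \<odot> X r = X r \<odot> (\<xi>, \<xi>)"
      by (simp add: G_def pmult_assoc) (simp add: pmult_def)
    then show ?thesis
      by (simp add: G[OF r])
  qed
  then show ?thesis
    using that[of "ball q e" \<xi> "G q"] e gen by auto
qed

lemma omega_nonzero:
  assumes "q \<in> U"
  shows "omega q (axis 1 1) \<noteq> 0"
  using omega_21_nonzero[OF assms] by (auto simp: cxentry_linear)

text \<open>A converse of \<open>local_torus\<close>: it recovers the direction of the tangent plane from the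
  torus that contains the surface.\<close>

lemma torus_commutes:
  assumes V: "open V" "V \<subseteq> U" "r \<in> V" and X: "\<And>r. r \<in> V \<Longrightarrow> X r \<odot> x = H \<odot> X r"
  shows "omega r h \<odot> x = x \<odot> omega r h"
proof -
  have r: "r \<in> U" using V by auto
  have "dderiv X U r h \<odot> x = H \<odot> dderiv X U r h"
    by (rule intertwining_derivative[OF V(1,3) dX[OF r] X])
  then have "X r \<odot> (omega r h \<odot> x) = (H \<odot> X r) \<odot> omega r h"
    by (simp add: dX_omega[OF r] pmult_assoc)
  also have "\<dots> = X r \<odot> (x \<odot> omega r h)"
    by (simp add: X[OF V(3), symmetric] pmult_assoc)
  finally show ?thesis
    using pmult_padj_cancel(2)[OF X_in[OF r]] by metis
qed

end

text \<open>The centralizer of a nonzero trace-zero \<open>2 \<times> 2\<close> matrix among trace-zero matrices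
  is a line.\<close>

lemma commutes_line_gen:
  fixes \<alpha> \<xi> :: mat2
  assumes "trace \<alpha> = 0" "line_gen \<xi>" "\<alpha> ** \<xi> = \<xi> ** \<alpha>"
  shows "\<alpha> = \<alpha> $ 2 $ 1 *\<^sub>R \<xi>"
proof -
  have t: "\<alpha> $ 2 $ 2 = - \<alpha> $ 1 $ 1" "\<xi> $ 2 $ 2 = - \<xi> $ 1 $ 1" "\<xi> $ 2 $ 1 = 1"
    using assms by (auto simp: line_gen_def trace_nth)
  have "(\<alpha> ** \<xi>) $ 1 $ 1 = (\<xi> ** \<alpha>) $ 1 $ 1" "(\<alpha> ** \<xi>) $ 2 $ 1 = (\<xi> ** \<alpha>) $ 2 $ 1"
    using assms(3) by simp_all
  then have "\<alpha> $ 1 $ 2 = \<alpha> $ 2 $ 1 * \<xi> $ 1 $ 2" "2 * \<alpha> $ 1 $ 1 = 2 * (\<alpha> $ 2 $ 1 * \<xi> $ 1 $ 1)"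
    unfolding mult_nth t by algebra+
  then show ?thesis
    by (simp add: mat2_eq_iff t)
qed

lemma line_gen_unique:
  assumes "w \<noteq> 0" "w \<in> sl2_pairs" "line_gen \<xi>" "line_gen \<xi>'"
    "w \<odot> (\<xi>, \<xi>) = (\<xi>, \<xi>) \<odot> w" "w \<odot> (\<xi>', \<xi>') = (\<xi>', \<xi>') \<odot> w"
  shows "\<xi> = \<xi>'"
proof -
  have c: "fst w ** \<xi> = \<xi> ** fst w" "fst w ** \<xi>' = \<xi>' ** fst w"
    "snd w ** \<xi> = \<xi> ** snd w" "snd w ** \<xi>' = \<xi>' ** snd w"
    using assms(5,6) by (simp_all add: pmult_def)
  have "fst w \<noteq> 0 \<or> snd w \<noteq> 0"
    using assms(1) by (simp add: prod_eq_iff)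
  then obtain \<alpha> where \<alpha>: "\<alpha> \<noteq> 0" "trace \<alpha> = 0" "\<alpha> ** \<xi> = \<xi> ** \<alpha>" "\<alpha> ** \<xi>' = \<xi>' ** \<alpha>"
    using c assms(2) unfolding sl2_pairs_def by blast
  have "\<alpha> = \<alpha> $ 2 $ 1 *\<^sub>R \<xi>" "\<alpha> = \<alpha> $ 2 $ 1 *\<^sub>R \<xi>'"
    using commutes_line_gen \<alpha> assms by blast+
  then show ?thesis
    using \<alpha>(1) by (metis scaleR_cancel_left scaleR_zero_left)
qed

section \<open>Globalization by connectedness\<close>

lemma open_patch_image:
  assumes "open U" "openin M (x ` U)" "embedding_map (top_of_set U) M x" "open V" "V \<subseteq> U"
  shows "openin M (x ` V)"
proof -
  have "homeomorphic_map (top_of_set U) (subtopology M (x ` U)) x"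
    using assms(3) by (simp add: embedding_map_def)
  then have "open_map (top_of_set U) (subtopology M (x ` U)) x"
    by (rule homeomorphic_imp_open_map)
  moreover have "openin (top_of_set U) V"
    using assms by (auto simp: openin_open)
  ultimately have "openin (subtopology M (x ` U)) (x ` V)"
    by (simp add: open_map_def)
  then show ?thesis
    using assms(2) openin_trans_full by blast
qed

lemma open_patch_preimage:
  assumes "open U" "embedding_map (top_of_set U) M x" "openin M W"
  shows "open {r \<in> U. x r \<in> W}"
proof -
  have "continuous_map (top_of_set U) M x"
    using assms(2) homeomorphic_imp_continuous_map continuous_map_in_subtopology
    unfolding embedding_map_def by blast
  then have "openin (top_of_set U) {r \<in> U. x r \<in> W}"
    using assms(3) by (auto dest: openin_continuous_map_preimage)
  then show ?thesis
    using assms(1) openin_open_eq by blast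
qed

text \<open>Stated through the immersion and neighbourhoods in \<open>M\<close> alone, so that no change of
  charts is needed to compare the data obtained in two overlapping patches.\<close>

definition torus_near ::
  "'m topology \<Rightarrow> ('m \<Rightarrow> mat2 \<times> mat2) \<Rightarrow> 'm \<Rightarrow> mat2 \<times> (mat2 \<times> mat2) \<Rightarrow> bool" where
  "torus_near M F m = (\<lambda>(\<xi>, H). line_gen \<xi> \<and>
     (\<exists>W. openin M W \<and> m \<in> W \<and> (\<forall>m'\<in>W. F m' \<odot> (\<xi>, \<xi>) = H \<odot> F m')))"

text \<open>The points with label \<open>t0\<close> and the points with any other label are disjoint open sets
  covering \<open>M\<close>.\<close>

lemma connected_locally_unique_choice:
  assumes conn: "connected_space M" and m0: "m0 \<in> topspace M" "Q m0 t0"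
    and ex: "\<And>m. m \<in> topspace M \<Longrightarrow> \<exists>t. Q m t"
    and unique: "\<And>m t t'. m \<in> topspace M \<Longrightarrow> Q m t \<Longrightarrow> Q m t' \<Longrightarrow> t = t'"
    and op: "\<And>m t. m \<in> topspace M \<Longrightarrow> Q m t \<Longrightarrow> \<exists>W. openin M W \<and> m \<in> W \<and> (\<forall>m'\<in>W. Q m' t)"
    and m: "m \<in> topspace M"
  shows "Q m t0"
proof -
  define E1 where "E1 = {m \<in> topspace M. Q m t0}"
  define E2 where "E2 = {m \<in> topspace M. \<exists>t. t \<noteq> t0 \<and> Q m t}"
  have "openin M E1"
    unfolding openin_subopen[of M E1]
  proof
    fix m assume "m \<in> E1"
    then obtain W where "openin M W" "m \<in> W" "\<forall>m'\<in>W. Q m' t0"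
      using op[of m t0] by (auto simp: E1_def)
    then show "\<exists>T. openin M T \<and> m \<in> T \<and> T \<subseteq> E1"
      using openin_subset[of M W] by (intro exI[of _ W]) (auto simp: E1_def)
  qed
  moreover have "openin M E2"
    unfolding openin_subopen[of M E2]
  proof
    fix m assume "m \<in> E2"
    then obtain t where t: "t \<noteq> t0" "Q m t" "m \<in> topspace M" by (auto simp: E2_def)
    then obtain W where "openin M W" "m \<in> W" "\<forall>m'\<in>W. Q m' t"
      using op[of m t] by auto
    then show "\<exists>T. openin M T \<and> m \<in> T \<and> T \<subseteq> E2"
      using openin_subset[of M W] t(1) by (intro exI[of _ W]) (auto simp: E2_def)
  qed
  moreover have "topspace M \<subseteq> E1 \<union> E2"
  proof
    fix m assume m: "m \<in> topspace M"
    then obtain t where "Q m t" using ex by blast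
    then show "m \<in> E1 \<union> E2"
      using m by (cases "t = t0") (auto simp: E1_def E2_def)
  qed
  moreover have "E1 \<inter> E2 = {}"
    using unique unfolding E1_def E2_def by blast
  moreover have "E1 \<noteq> {}"
    using m0 by (auto simp: E1_def)
  ultimately have "E2 = {}"
    using conn unfolding connected_space_def by blast
  then show ?thesis
    using ex[OF m] m unfolding E2_def by auto
qed

text \<open>Each patch yields the data near each of its points by \<open>local_torus\<close>. They are unique:
  by \<open>torus_commutes\<close> the nonzero \<open>omega\<close> commutes with both candidates for
  \<open>\<xi>\<close>, and \<open>H\<close> is the conjugate of \<open>(\<xi>, \<xi>)\<close> by
  \<open>F m\<close>.\<close>

lemma global_torus:
  assumes surf: "smooth_surface M P" and conn: "connected_space M"
    and patch: "\<And>U x. (U, x) \<in> P \<Longrightarrow> negative_patch U (F \<circ> x)"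
    and ne: "topspace M \<noteq> {}"
  obtains \<xi> H where "line_gen \<xi>" "\<And>m. m \<in> topspace M \<Longrightarrow> F m \<odot> (\<xi>, \<xi>) = H \<odot> F m"
proof -
  have chart: "open U" "openin M (x ` U)" "embedding_map (top_of_set U) M x" if "(U, x) \<in> P" for U x
    using surf that unfolding smooth_surface_def by blast+
  have cover: "\<exists>U x q. (U, x) \<in> P \<and> q \<in> U \<and> m = x q" if "m \<in> topspace M" for m
    using surf that unfolding smooth_surface_def by blast
  have ex: "\<exists>t. torus_near M F m t" if m: "m \<in> topspace M" for m
  proof -
    obtain U x q where P: "(U, x) \<in> P" and q: "q \<in> U" "m = x q"
      using cover[OF m] by blast
    interpret negative_patch U "F \<circ> x" by (rule patch[OF P])
    obtain V \<xi> H where V: "open V" "q \<in> V" "V \<subseteq> U" "line_gen \<xi>"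
      "\<And>r. r \<in> V \<Longrightarrow> (F \<circ> x) r \<odot> (\<xi>, \<xi>) = H \<odot> (F \<circ> x) r"
      using local_torus[OF q(1)] by metis
    then have "torus_near M F m (\<xi>, H)"
      unfolding torus_near_def using open_patch_image[OF chart[OF P] V(1,3)] q
      by (auto intro!: exI[of _ "x ` V"])
    then show ?thesis by blast
  qed
  have unique: "t = t'" if m: "m \<in> topspace M" and tt: "torus_near M F m t" "torus_near M F m t'" for m t t'
  proof -
    obtain U x q where P: "(U, x) \<in> P" and q: "q \<in> U" "m = x q"
      using cover[OF m] by blast
    interpret negative_patch U "F \<circ> x" by (rule patch[OF P])
    obtain \<xi> H \<xi>' H' where t: "t = (\<xi>, H)" "t' = (\<xi>', H')"
      by (metis surj_pair)
    have gen: "line_gen \<xi>" "line_gen \<xi>'"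
      using tt by (auto simp: t torus_near_def)
    obtain W where W: "openin M W" "m \<in> W" "\<And>m'. m' \<in> W \<Longrightarrow> F m' \<odot> (\<xi>, \<xi>) = H \<odot> F m'"
      using tt(1) by (auto simp: t torus_near_def)
    obtain W' where W': "openin M W'" "m \<in> W'" "\<And>m'. m' \<in> W' \<Longrightarrow> F m' \<odot> (\<xi>', \<xi>') = H' \<odot> F m'"
      using tt(2) by (auto simp: t torus_near_def)
    have c: "omega q h \<odot> (\<xi>, \<xi>) = (\<xi>, \<xi>) \<odot> omega q h" for h
      by (rule torus_commutes[OF open_patch_preimage[OF chart(1,3)[OF P] W(1)]])
         (use q W in auto)
    have c': "omega q h \<odot> (\<xi>', \<xi>') = (\<xi>', \<xi>') \<odot> omega q h" for h
      by (rule torus_commutes[OF open_patch_preimage[OF chart(1,3)[OF P] W'(1)]])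
         (use q W' in auto)
    have \<xi>: "\<xi> = \<xi>'"
      by (rule line_gen_unique[OF omega_nonzero[OF q(1)] omega_sl2[OF q(1)] gen c c'])
    have "F m \<in> SL2xSL2"
      using X_in[OF q(1)] q by simp
    then have inv: "F m \<odot> padj (F m) = (mat 1, mat 1)"
      by (auto simp: SL2xSL2_def padj_def pmult_def mult_adj2)
    have "H \<odot> F m = H' \<odot> F m"
      using W(3)[OF W(2)] W'(3)[OF W'(2)] \<xi> by simp
    then have "H \<odot> (F m \<odot> padj (F m)) = H' \<odot> (F m \<odot> padj (F m))"
      by (metis pmult_assoc)
    then have "H = H'"
      unfolding inv by (simp add: pmult_def prod_eq_iff)
    then show ?thesis
      by (simp add: t \<xi>)
  qed
  obtain m0 where m0: "m0 \<in> topspace M"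
    using ne by blast
  obtain t0 where t0: "torus_near M F m0 t0"
    using ex[OF m0] by blast
  have op: "\<exists>W. openin M W \<and> m \<in> W \<and> (\<forall>m'\<in>W. torus_near M F m' t)"
    if "torus_near M F m t" for m t
    using that unfolding torus_near_def by (auto split: prod.splits)
  have all: "torus_near M F m t0" if "m \<in> topspace M" for m
    by (rule connected_locally_unique_choice[where Q="torus_near M F", OF conn m0 t0 ex unique op that])
  obtain \<xi> H where "t0 = (\<xi>, H)" by (cases t0)
  then show ?thesis
    using that[of \<xi> H] all m0 by (auto simp: torus_near_def)
qed

text \<open>Left translations preserve \<open>g_SL\<close> by construction. Conjugation of both factors by the
  same matrix preserves it because the trace form is invariant under conjugation. The determinant of
  \<open>g\<close> may be negative.\<close>

lemma conjugate_translation_isometry: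
  fixes g g' :: mat2
  assumes p0: "p0 \<in> SL2xSL2" and g: "g ** g' = mat 1" "g' ** g = mat 1"
  defines "\<Phi> \<equiv> \<lambda>p. (g', g') \<odot> (padj p0 \<odot> p) \<odot> (g, g)"
  shows "is_isometry SL2xSL2 tangent_SL g_SL \<Phi>" "bounded_linear \<Phi>" "inj \<Phi>"
proof -
  let ?S = "SL2xSL2" and ?G = "(g, g)" and ?G' = "(g', g')"
  define \<Psi> where "\<Psi> p = p0 \<odot> (?G \<odot> p \<odot> ?G')" for p
  have canc: "?G \<odot> (?G' \<odot> p) = p" "?G' \<odot> (?G \<odot> p) = p" "p \<odot> ?G \<odot> ?G' = p" "p \<odot> ?G' \<odot> ?G = p" for p
    using g by (simp_all add: pmult_def matrix_mul_assoc) (simp_all add: g flip: matrix_mul_assoc)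
  have inv: "\<Psi> (\<Phi> p) = p" "\<Phi> (\<Psi> p) = p" for p
    unfolding \<Phi>_def \<Psi>_def using canc
    by (simp_all add: pmult_assoc pmult_padj_cancel[OF p0])
  have lin: "bounded_linear \<Phi>" "bounded_linear \<Psi>"
    unfolding \<Phi>_def \<Psi>_def[abs_def]
    by (intro bounded_linear_compose[OF pmult.bounded_linear_left] bounded_linear_compose[OF pmult.bounded_linear_right]
        pmult.bounded_linear_left pmult.bounded_linear_right bounded_linear_ident)+
  have detg: "det g * det g' = 1" "det g' * det g = 1"
    using arg_cong[OF g(1), of det] arg_cong[OF g(2), of det] by (simp_all add: det_mul)
  have "det (adj2 A) = det A" for A
    by (simp add: det_2 adj2_nth mult.commute)
  then have S: "\<Phi> p \<in> ?S" "\<Psi> p \<in> ?S" if "p \<in> ?S" for p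
    using that p0 detg
    by (auto simp: SL2xSL2_def \<Phi>_def \<Psi>_def pmult_def padj_def det_mul)
  show "bounded_linear \<Phi>" by (rule lin)
  show inj: "inj \<Phi>" using inv(1) by (metis injI)
  show "is_isometry ?S tangent_SL g_SL \<Phi>"
    unfolding is_isometry_def
  proof (intro conjI ballI)
    show bij: "bij_betw \<Phi> ?S ?S"
      by (rule bij_betw_byWitness[where f'=\<Psi>]) (use inv S in auto)
    show "smooth_on ?S \<Phi>"
      by (rule smooth_on_bounded_linear[OF lin(1)])
    have "inv_into ?S \<Phi> p = \<Psi> p" if "p \<in> ?S" for p
      by (rule inv_into_f_eq) (use inj_on_subset[OF inj] S inv that in auto)
    then show "smooth_on ?S (inv_into ?S \<Phi>)"
      unfolding smooth_on_def
      by (intro ballI exI[of _ UNIV] exI[of _ \<Psi>]) (auto simp: Ck_bounded_linear[OF lin(2)])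
    fix p v w assume p: "p \<in> ?S" and vw: "v \<in> tangent_SL p" "w \<in> tangent_SL p"
    obtain x y where xy: "v = p \<odot> x" "w = p \<odot> y"
      using vw by (auto simp: tangent_SL_eq)
    have d: "dderiv \<Phi> ?S p v = \<Phi> v" if "v \<in> tangent_SL p" for v
      by (rule dderiv_SL_eq[OF p that bounded_linear.has_derivative[OF lin(1) has_derivative_ident]])
    have \<Phi>x: "\<Phi> (p \<odot> x) = \<Phi> p \<odot> (?G' \<odot> x \<odot> ?G)" for x
      unfolding \<Phi>_def by (simp add: pmult_assoc canc)
    have tr: "tr_form (g' ** \<alpha> ** g) (g' ** \<beta> ** g) = tr_form \<alpha> \<beta>" for \<alpha> \<beta>
    proof -
      have "(g' ** \<alpha> ** g) ** (g' ** \<beta> ** g) = g' ** \<alpha> ** (g ** g') ** \<beta> ** g"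
        by (simp add: matrix_mul_assoc)
      also have "\<dots> = g' ** (\<alpha> ** \<beta> ** g)"
        by (simp add: g matrix_mul_assoc)
      also have "trace \<dots> = trace (\<alpha> ** \<beta> ** g ** g')"
        by (rule trace_mul_sym)
      also have "\<dots> = trace (\<alpha> ** \<beta>)"
        by (simp add: g flip: matrix_mul_assoc)
      finally show ?thesis by (simp add: tr_form_def)
    qed
    have "g_SL (\<Phi> p) (\<Phi> v) (\<Phi> w) = g0 (?G' \<odot> x \<odot> ?G) (?G' \<odot> y \<odot> ?G)"
      by (simp add: xy \<Phi>x g_SL_eq[OF S(1)[OF p]] pmult_padj_cancel[OF S(1)[OF p]])
    also have "\<dots> = g0 x y"
      by (simp add: g0_def pmult_def tr)
    also have "\<dots> = g_SL p v w"
      by (simp add: xy g_SL_eq[OF p] pmult_padj_cancel[OF p])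
    finally show "g_SL (\<Phi> p) (dderiv \<Phi> ?S p v) (dderiv \<Phi> ?S p w) = g_SL p v w"
      by (simp add: d vw)
  qed
qed

text \<open>Rotation by a right angle, the generator of the rotation group in the parametrization
  \<open>rot\<close>.\<close>

definition Jm :: mat2 where
  "Jm = vector [vector [0, 1], vector [-1, 0]]"

lemma commutes_Jm: "A ** Jm = Jm ** A \<longleftrightarrow> A $ 2 $ 2 = A $ 1 $ 1 \<and> A $ 2 $ 1 = - A $ 1 $ 2"
  by (auto simp: mat2_simps Jm_def)

lemma rot_iff: "(\<exists>\<theta>. A = rot \<theta>) \<longleftrightarrow> det A = 1 \<and> A ** Jm = Jm ** A"
proof
  assume "\<exists>\<theta>. A = rot \<theta>"
  then show "det A = 1 \<and> A ** Jm = Jm ** A"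
    by (auto simp: commutes_Jm rot_def det_2 simp flip: power2_eq_square)
next
  assume A: "det A = 1 \<and> A ** Jm = Jm ** A"
  then have "(A $ 1 $ 1)\<^sup>2 + (A $ 1 $ 2)\<^sup>2 = 1"
    unfolding commutes_Jm det_2 by (auto simp: power2_eq_square)
  then obtain \<theta> where "A $ 1 $ 1 = cos \<theta>" "A $ 1 $ 2 = sin \<theta>"
    using sincos_total_2pi by metis
  then show "\<exists>\<theta>. A = rot \<theta>"
    using A unfolding commutes_Jm by (intro exI[of _ \<theta>]) (simp add: mat2_eq_iff rot_def)
qed

text \<open>The parameters \<open>(s, t)\<close> and the two angles are related by an invertible linear map, so
  the range is the full torus of pairs of rotations, which is the centralizer of \<open>(Jm,
  Jm)\<close>.\<close>

lemma range_flat_immersion: "range flat_immersion = {p \<in> SL2xSL2. p \<odot> (Jm, Jm) = (Jm, Jm) \<odot> p}"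
proof -
  have "range flat_immersion = {(rot a, rot b) |a b. True}"
  proof (intro equalityI subsetI)
    fix p assume "p \<in> {(rot a, rot b) |a b. True}"
    then obtain a b where p: "p = (rot a, rot b)" by blast
    have "p = flat_immersion ((a + b) / (sqrt 2 * sqrt 3), (b - a) / sqrt 2)"
    proof -
      have "sqrt 2 * sqrt 2 = (2::real)" by simp
      then have "1 / sqrt 2 * (sqrt 3 * ((a + b) / (sqrt 2 * sqrt 3)) - (b - a) / sqrt 2) = a"
        "1 / sqrt 2 * (sqrt 3 * ((a + b) / (sqrt 2 * sqrt 3)) + (b - a) / sqrt 2) = b"
        by (simp_all add: field_simps)
      then show ?thesis
        by (simp add: p flat_immersion_def)
    qed
    then show "p \<in> range flat_immersion" by blast
  qed (auto simp: flat_immersion_def)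
  also have "\<dots> = {p \<in> SL2xSL2. p \<odot> (Jm, Jm) = (Jm, Jm) \<odot> p}"
  proof -
    have "{(rot a, rot b) |a b. True} = {p. (\<exists>a. fst p = rot a) \<and> (\<exists>b. snd p = rot b)}"
      by auto
    then show ?thesis
      unfolding rot_iff by (auto simp: SL2xSL2_def pmult_def)
  qed
  finally show ?thesis .
qed

section \<open>Open subsets of the torus and the classification\<close>

text \<open>Near \<open>p1\<close> the torus has the coordinates \<open>L\<close>, the sines of the two angles
  relative to \<open>p1\<close>; they are injective on the set \<open>N\<close> where both cosines are
  positive. In these coordinates the map has bijective derivative at \<open>q\<close>, so it covers a
  neighbourhood.\<close>

lemma torus_immersion_open_image:
  fixes Y :: "real^2 \<Rightarrow> mat2 \<times> mat2"
  assumes "open U" and der: "\<And>q. q \<in> U \<Longrightarrow> (Y has_derivative D q) (at q)"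
    and inj: "\<And>q. q \<in> U \<Longrightarrow> inj (D q)" and Y: "Y ` U \<subseteq> range flat_immersion"
  shows "openin (top_of_set (range flat_immersion)) (Y ` U)"
  unfolding openin_subopen[of _ "Y ` U"]
proof
  let ?S = "range flat_immersion"
  fix p1 assume "p1 \<in> Y ` U"
  then obtain q where q: "q \<in> U" "p1 = Y q" by blast
  have YS: "Y r \<in> SL2xSL2" "Y r \<odot> (Jm, Jm) = (Jm, Jm) \<odot> Y r" if "r \<in> U" for r
    using Y that unfolding range_flat_immersion by auto
  note p1 = YS[OF q(1), folded q(2)]
  define L where "L p = (vector [fst (padj p1 \<odot> p) $ 1 $ 2, snd (padj p1 \<odot> p) $ 1 $ 2] :: real^2)" for p
  define N where "N = {p. fst (padj p1 \<odot> p) $ 1 $ 1 > 0 \<and> snd (padj p1 \<odot> p) $ 1 $ 1 > 0}"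
  have linL: "bounded_linear L"
    by (intro linear_conv_bounded_linear[THEN iffD1] linearI)
       (simp_all add: L_def vec_eq_iff forall_2 pmult.add_right pmult.scaleR_right)
  have lin11: "bounded_linear (\<lambda>p. fst (padj p1 \<odot> p) $ 1 $ 1)" "bounded_linear (\<lambda>p. snd (padj p1 \<odot> p) $ 1 $ 1)"
    by (intro linear_conv_bounded_linear[THEN iffD1] linearI;
        simp add: pmult.add_right pmult.scaleR_right)+
  have "open N"
    unfolding N_def
    by (intro open_Collect_conj open_Collect_less continuous_on_const linear_continuous_on lin11)
  have one: "padj p1 \<odot> p1 = (mat 1, mat 1)"
    using p1 by (auto simp: SL2xSL2_def padj_def pmult_def mult_adj2)
  have p1N: "p1 \<in> N" and L1: "L p1 = 0"
    by (simp_all add: N_def L_def one mat_1_nth vec_eq_iff forall_2)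
  have Jadj: "padj p1 \<odot> (Jm, Jm) = (Jm, Jm) \<odot> padj p1"
  proof -
    have "padj (p1 \<odot> (Jm, Jm)) = padj ((Jm, Jm) \<odot> p1)"
      using p1(2) by simp
    moreover have "padj (Jm, Jm) = - (Jm, Jm)"
      by (intro padj_sl2) (simp add: sl2_pairs_def Jm_def trace_nth)
    ultimately show ?thesis
      by (simp only: padj_pmult pmult.minus_left pmult.minus_right neg_equal_iff_equal)
  qed
  have comm: "(padj p1 \<odot> p) \<odot> (Jm, Jm) = (Jm, Jm) \<odot> (padj p1 \<odot> p)"
    if "p \<odot> (Jm, Jm) = (Jm, Jm) \<odot> p" for p
    by (metis that Jadj pmult_assoc)
  have commD: "fst z $ 2 $ 2 = fst z $ 1 $ 1" "fst z $ 2 $ 1 = - fst z $ 1 $ 2"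
      "snd z $ 2 $ 2 = snd z $ 1 $ 1" "snd z $ 2 $ 1 = - snd z $ 1 $ 2"
    if "z \<odot> (Jm, Jm) = (Jm, Jm) \<odot> z" for z
    using that commutes_Jm by (auto simp: pmult_def)
  have inN: "p = p'" if "p \<in> ?S" "p' \<in> ?S" "p \<in> N" "p' \<in> N" "L p = L p'" for p p'
  proof -
    define z z' where "z = padj p1 \<odot> p" and "z' = padj p1 \<odot> p'"
    have zJ: "z \<odot> (Jm, Jm) = (Jm, Jm) \<odot> z" "z' \<odot> (Jm, Jm) = (Jm, Jm) \<odot> z'"
      using comm that(1,2) unfolding range_flat_immersion z_def z'_def by auto
    have "padj p1 \<in> SL2xSL2"
      using p1 by (auto simp: SL2xSL2_def padj_def det_2 adj2_nth mult.commute)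
    then have "z \<in> SL2xSL2" "z' \<in> SL2xSL2"
      using that(1,2) pmult_SL unfolding range_flat_immersion z_def z'_def by auto
    then have d: "det (fst z) = 1" "det (snd z) = 1" "det (fst z') = 1" "det (snd z') = 1"
      by (auto simp: SL2xSL2_def)
    have s: "fst z $ 1 $ 2 = fst z' $ 1 $ 2" "snd z $ 1 $ 2 = snd z' $ 1 $ 2"
      using that(5) by (auto simp: L_def z_def z'_def vec_eq_iff forall_2)
    have pos: "fst z $ 1 $ 1 > 0" "snd z $ 1 $ 1 > 0" "fst z' $ 1 $ 1 > 0" "snd z' $ 1 $ 1 > 0"
      using that(3,4) by (auto simp: N_def z_def z'_def)
    have "(fst z $ 1 $ 1)\<^sup>2 = (fst z' $ 1 $ 1)\<^sup>2" "(snd z $ 1 $ 1)\<^sup>2 = (snd z' $ 1 $ 1)\<^sup>2"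
      using d s commD[OF zJ(1)] commD[OF zJ(2)] by (auto simp: det_2 power2_eq_square)
    then have "fst z $ 1 $ 1 = fst z' $ 1 $ 1" "snd z $ 1 $ 1 = snd z' $ 1 $ 1"
      using pos by (auto simp: power2_eq_iff)
    then have "z = z'"
      using s commD[OF zJ(1)] commD[OF zJ(2)] by (simp add: prod_eq_iff mat2_eq_iff)
    then show ?thesis
      unfolding z_def z'_def by (metis pmult_padj_cancel(1)[OF p1(1)])
  qed
  \<comment> \<open>The coordinates also detect tangent vectors of the torus: such a vector, translated to the identity,
    is a pair of multiples of \<open>Jm\<close>, which its upper right entries determine.\<close>
  have lin: "linear (L \<circ> D q)"
    using linear_compose[OF has_derivative_linear[OF der[OF q(1)]] bounded_linear.linear[OF linL]] .
  have "inj (L \<circ> D q)"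
  proof (rule linear_injective_0[OF lin, THEN iffD2, rule_format])
    fix h assume h: "(L \<circ> D q) h = 0"
    define z where "z = padj p1 \<odot> D q h"
    have zJ: "z \<odot> (Jm, Jm) = (Jm, Jm) \<odot> z"
      unfolding z_def by (intro comm intertwining_derivative[OF \<open>open U\<close> q(1) der[OF q(1)] YS(2)])
    have "z \<in> sl2_pairs"
      unfolding z_def q(2) by (rule SL_valued_derivative[OF \<open>open U\<close> q(1) der[OF q(1)] YS(1)])
    then have "fst z $ 1 $ 1 = 0" "snd z $ 1 $ 1 = 0"
      using commD[OF zJ] by (auto simp: sl2_pairs_def trace_nth)
    moreover have "fst z $ 1 $ 2 = 0" "snd z $ 1 $ 2 = 0"
      using h by (auto simp: L_def z_def vec_eq_iff forall_2)
    ultimately have "z = 0"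
      using commD[OF zJ] by (simp add: prod_eq_iff mat2_eq_iff)
    then have "D q h = 0"
      using pmult_padj_cancel(1)[OF p1(1), of "D q h"] by (simp add: z_def pmult.zero_right)
    then show "h = 0"
      using inj[OF q(1)] linear_injective_0[OF has_derivative_linear[OF der[OF q(1)]]] by blast
  qed
  then obtain G where G: "linear G" "(L \<circ> D q) \<circ> G = id"
    using linear_injective_imp_surjective[OF lin] linear_surjective_right_inverse[OF lin] by blast
  define T where "T = {r \<in> U. Y r \<in> N}"
  have contY: "continuous_on U Y"
    using der has_derivative_continuous continuous_at_imp_continuous_on by blast
  have "open T"
    using continuous_open_preimage[OF contY \<open>open U\<close> \<open>open N\<close>] unfolding T_def vimage_def Int_def by simp
  have "(L \<circ> Y) q \<in> interior ((L \<circ> Y) ` T)"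
  proof (rule sussmann_open_mapping[OF \<open>open U\<close> _ q(1) _ _ G(2)])
    show "continuous_on U (L \<circ> Y)"
      using contY linear_continuous_on[OF linL] continuous_on_compose by blast
    show "(L \<circ> Y has_derivative L \<circ> D q) (at q)"
      using bounded_linear.has_derivative[OF linL der[OF q(1)]] by (simp add: o_def)
    show "bounded_linear G"
      using G(1) by (simp add: linear_conv_bounded_linear)
    show "T \<subseteq> U" by (auto simp: T_def)
    show "q \<in> interior T"
      using \<open>open T\<close> q p1N by (simp add: interior_open T_def)
  qed
  then have LO: "L p1 \<in> interior ((L \<circ> Y) ` T)"
    by (simp add: q(2))
  define O' where "O' = N \<inter> L -` interior ((L \<circ> Y) ` T)"
  have "open O'"
    unfolding O'_def using \<open>open N\<close> linear_continuous_on[OF linL]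
    by (intro open_Int open_vimage open_interior)
  then have "openin (top_of_set ?S) (?S \<inter> O')"
    by (simp add: openin_open_Int)
  moreover have "p1 \<in> ?S \<inter> O'"
    using LO p1N Y q by (auto simp: O'_def)
  moreover have "?S \<inter> O' \<subseteq> Y ` U"
  proof
    fix p assume p: "p \<in> ?S \<inter> O'"
    then have "L p \<in> (L \<circ> Y) ` T"
      using interior_subset by (auto simp: O'_def)
    then obtain r where r: "r \<in> T" "L p = L (Y r)" by auto
    have "p = Y r"
      using p r Y by (intro inN) (auto simp: O'_def T_def)
    then show "p \<in> Y ` U"
      using r(1) by (auto simp: T_def)
  qed
  ultimately show "\<exists>T. openin (top_of_set ?S) T \<and> p1 \<in> T \<and> T \<subseteq> Y ` U"
    by blast
qed

text \<open>One has \<open>\<xi> ** \<xi> = - (r * r) *\<^sub>R mat 1\<close> with \<open>r\<close> the square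
  root of the determinant. If \<open>e\<close> is the first coordinate vector, then
  \<open>\<xi>\<close> maps \<open>r e\<close> to \<open>- r (- \<xi> e)\<close> and \<open>- \<xi>
  e\<close> to \<open>r (r e)\<close>. So the matrix \<open>g\<close> with columns \<open>r e\<close>
  and \<open>- \<xi> e\<close> conjugates \<open>\<xi>\<close> to \<open>r *\<^sub>R Jm\<close>.\<close>

lemma line_gen_conjugate:
  assumes "line_gen \<xi>"
  obtains g g' :: mat2 and r :: real where "g ** g' = mat 1" "g' ** g = mat 1" "r \<noteq> 0"
    "\<xi> ** g = g ** (r *\<^sub>R Jm)"
proof -
  define u v where "u = \<xi> $ 1 $ 1" and "v = \<xi> $ 1 $ 2"
  have xi: "\<xi> $ 1 $ 1 = u" "\<xi> $ 1 $ 2 = v" "\<xi> $ 2 $ 1 = 1" "\<xi> $ 2 $ 2 = - u" and neg: "- (u * u) - v > 0"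
  proof -
    show "\<xi> $ 1 $ 1 = u" "\<xi> $ 1 $ 2 = v" "\<xi> $ 2 $ 1 = 1" and 22: "\<xi> $ 2 $ 2 = - u"
      using assms by (simp_all add: line_gen_def trace_nth u_def v_def)
    show "- (u * u) - v > 0"
      using assms 22 by (auto simp: line_gen_def det_2 u_def v_def)
  qed
  define r where "r = sqrt (- (u * u) - v)"
  have r: "r > 0" "r * r = - (u * u) - v"
    using neg by (auto simp: r_def)
  define g :: mat2 where "g = vector [vector [r, - u], vector [0, - 1]]"
  define g' :: mat2 where "g' = vector [vector [1 / r, - u / r], vector [0, - 1]]"
  show ?thesis
  proof (rule that[of g g' r])
    show "g ** g' = mat 1" "g' ** g = mat 1"
      using r by (simp_all add: mat2_simps g_def g'_def)
    show "r \<noteq> 0" using r by simp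
    show "\<xi> ** g = g ** (r *\<^sub>R Jm)"
      using r by (simp add: mat2_simps g_def Jm_def xi)
  qed
qed

theorem proposition4p3:
  fixes M :: "'m topology"
    and P :: "((real^2) set \<times> (real^2 \<Rightarrow> 'm)) set"
    and F :: "'m \<Rightarrow> (real^2^2) \<times> (real^2^2)"
  assumes "almost_complex_surface M P F"
    and "negative_definite_metric P F"
    and "totally_geodesic P F"
    and "flat P F"
  shows "congruent_to M F (range flat_immersion)"
proof (cases "topspace M = {}")
  case True
  have "mat 1 ** mat 1 = (mat 1 :: mat2)" by simp
  then have "\<exists>\<Phi>. is_isometry SL2xSL2 tangent_SL g_SL \<Phi>"
    using conjugate_translation_isometry(1)[of "(mat 1, mat 1)" "mat 1" "mat 1"]
    by (auto simp: SL2xSL2_def)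
  then show ?thesis
    using True by (auto simp: congruent_to_def)
next
  case False
  have surf: "smooth_surface M P" and conn: "connected_space M"
    and imm: "immersion_into SL2xSL2 P F"
    and Jinv: "\<forall>(U, x)\<in>P. \<forall>q\<in>U.
      J_SL (F (x q)) ` range (dderiv (F \<circ> x) U q) \<subseteq> range (dderiv (F \<circ> x) U q)"
    using assms(1) unfolding almost_complex_surface_def by simp_all
  have cover: "topspace M = (\<Union>(U, x)\<in>P. x ` U)"
    using surf unfolding smooth_surface_def by (elim conjE) (rule sym)
  have patch: "negative_patch U (F \<circ> x)" if P: "(U, x) \<in> P" for U x
  proof
    show "open U"
      using surf P unfolding smooth_surface_def by blast
    show "smooth_on U (F \<circ> x)"
      using imm P unfolding immersion_into_def by blast
    show "(F \<circ> x) q \<in> SL2xSL2" if "q \<in> U" for q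
      using imm P that unfolding immersion_into_def by blast
    show "J_SL ((F \<circ> x) q) ` range (dderiv (F \<circ> x) U q) \<subseteq> range (dderiv (F \<circ> x) U q)" if "q \<in> U" for q
    proof -
      have "J_SL (F (x q)) ` range (dderiv (F \<circ> x) U q) \<subseteq> range (dderiv (F \<circ> x) U q)"
        using bspec[OF Jinv P] that by simp
      then show ?thesis
        by (simp only: comp_apply)
    qed
    show "induced_metric g_SL U (F \<circ> x) q a a < 0" if "q \<in> U" "a \<noteq> 0" for q a
      using assms(2) P that unfolding negative_definite_metric_def by blast
    show "second_fundamental_form SL2xSL2 tangent_SL g_SL U (F \<circ> x) q a b = 0" if "q \<in> U" for q a b
      using assms(3) P that unfolding totally_geodesic_def by blast
  qed
  obtain \<xi> H where xi: "line_gen \<xi>" and H: "\<And>m. m \<in> topspace M \<Longrightarrow> F m \<odot> (\<xi>, \<xi>) = H \<odot> F m"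
    using global_torus[OF surf conn patch False] by metis
  obtain g g' r where g: "g ** g' = mat 1" "g' ** g = mat 1" and r: "r \<noteq> 0" and xig: "\<xi> ** g = g ** (r *\<^sub>R Jm)"
    using line_gen_conjugate[OF xi] by metis
  have FS: "F m \<in> SL2xSL2" if "m \<in> topspace M" for m
  proof -
    obtain U x q where "(U, x) \<in> P" "q \<in> U" "m = x q"
      using \<open>m \<in> topspace M\<close> unfolding cover by blast
    then show ?thesis
      using bspec[OF imm[unfolded immersion_into_def], of "(U, x)"] by auto
  qed
  obtain m0 where m0: "m0 \<in> topspace M"
    using False by blast
  define p0 where "p0 = F m0"
  have p0: "p0 \<in> SL2xSL2" "p0 \<odot> (\<xi>, \<xi>) = H \<odot> p0"
    using FS H m0 by (auto simp: p0_def)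
  define \<Phi> where "\<Phi> = (\<lambda>p. (g', g') \<odot> (padj p0 \<odot> p) \<odot> (g, g))"
  note iso = conjugate_translation_isometry[OF p0(1) g, folded \<Phi>_def]
  have torus: "\<Phi> (F m) \<in> range flat_immersion" if m: "m \<in> topspace M" for m
  proof -
    let ?K = "padj p0 \<odot> F m"
    have K: "?K \<odot> (\<xi>, \<xi>) = (\<xi>, \<xi>) \<odot> ?K"
    proof -
      have "?K \<odot> (\<xi>, \<xi>) = padj p0 \<odot> H \<odot> (p0 \<odot> ?K)"
        by (simp add: pmult_assoc H[OF m] pmult_padj_cancel[OF p0(1)])
      also have "\<dots> = padj p0 \<odot> (H \<odot> p0) \<odot> ?K"
        by (simp add: pmult_assoc)
      also have "\<dots> = (\<xi>, \<xi>) \<odot> ?K"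
        by (simp add: p0(2)[symmetric] pmult_padj_cancel[OF p0(1)])
      finally show ?thesis .
    qed
    have J: "Jm = (1 / r) *\<^sub>R (g' ** \<xi> ** g)"
    proof -
      have "g' ** \<xi> ** g = g' ** g ** (r *\<^sub>R Jm)"
        by (simp add: xig flip: matrix_mul_assoc)
      then show ?thesis
        using r by (simp add: g)
    qed
    have c: "(g' ** A ** g) ** Jm = Jm ** (g' ** A ** g)" if A: "A ** \<xi> = \<xi> ** A" for A
    proof -
      have "(g' ** A ** g) ** (g' ** \<xi> ** g) = g' ** A ** (g ** g') ** \<xi> ** g"
        by (simp add: matrix_mul_assoc)
      also have "\<dots> = g' ** (A ** \<xi>) ** g"
        by (simp add: g matrix_mul_assoc)
      also have "\<dots> = g' ** \<xi> ** (g ** g') ** A ** g"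
        by (simp add: g A matrix_mul_assoc)
      also have "\<dots> = (g' ** \<xi> ** g) ** (g' ** A ** g)"
        by (simp add: matrix_mul_assoc)
      finally show ?thesis
        unfolding J by (simp add: bounded_bilinear.scaleR_left[OF bounded_bilinear_mult]
            bounded_bilinear.scaleR_right[OF bounded_bilinear_mult])
    qed
    have "\<Phi> (F m) \<odot> (Jm, Jm) = (Jm, Jm) \<odot> \<Phi> (F m)"
      using K c[of "fst ?K"] c[of "snd ?K"] unfolding \<Phi>_def by (simp add: pmult_def)
    moreover have "\<Phi> (F m) \<in> SL2xSL2"
      using iso(1) FS[OF m] unfolding is_isometry_def bij_betw_def by blast
    ultimately show ?thesis
      by (simp add: range_flat_immersion)
  qed
  have image: "\<Phi> ` F ` topspace M = (\<Union>(U, x)\<in>P. (\<Phi> \<circ> (F \<circ> x)) ` U)"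
    unfolding cover image_UN by (intro SUP_cong refl) (auto simp: image_comp comp_assoc split: prod.splits)
  have "openin (top_of_set (range flat_immersion)) ((\<Phi> \<circ> (F \<circ> x)) ` U)" if P: "(U, x) \<in> P" for U x
  proof (rule torus_immersion_open_image)
    interpret negative_patch U "F \<circ> x" by (rule patch[OF P])
    show "open U" by (rule open_U)
    show "(\<Phi> \<circ> (F \<circ> x) has_derivative (\<lambda>h. \<Phi> (dderiv (F \<circ> x) U q h))) (at q)" if "q \<in> U" for q
      using bounded_linear.has_derivative[OF iso(2) dX[OF that]] by (simp add: o_def)
    show "inj (\<lambda>h. \<Phi> (dderiv (F \<circ> x) U q h))" if "q \<in> U" for q
    proof -
      have "inj (dderiv (F \<circ> x) U q)"
        using imm P that unfolding immersion_into_def by blast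
      from inj_compose[OF iso(3) this] show ?thesis
        by (simp add: o_def)
    qed
    have "x q \<in> topspace M" if "q \<in> U" for q
      using P that unfolding cover by blast
    then show "(\<Phi> \<circ> (F \<circ> x)) ` U \<subseteq> range flat_immersion"
      using torus by auto
  qed
  then have "openin (top_of_set (range flat_immersion)) (\<Phi> ` F ` topspace M)"
    unfolding image by (intro openin_Union) auto
  then show ?thesis
    using iso(1) unfolding congruent_to_def by blast
qed

end
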